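(* For $m\in\mathbb N^*$ let $\Psi_m(w)=\max\{m\log|w_1|,\log|w_2|\}$ on $\mathbb D^2$. Let $a_1,\dots,a_N\in\mathbb D$ be distinct, $m_1,\dots,m_N\in\mathbb N^*$, and $S=\{((a_1,0),\Psi_{m_1}),\dots,((a_N,0),\Psi_{m_N})\}$. Then for every $z\in\mathbb D^2$, $$L_S(z)=G_S(z)=\max\Big\{\sum_{j=1}^N m_j\log|\phi_{a_j}(z_1)|,\ \log|z_2|\Big\}.$$ Moreover, if for each $k$ the points $a^{(k)}_{j,i}\in\mathbb D$ ($1\le j\le N$, $1\le i\le m_j$) are distinct and $\lim_{k\to\infty}a^{(k)}_{j,i}=a_j$ for all $1\le i\le m_j$, and $S^{(k)}$ is the pole system consisting of all points $(a^{(k)}_{j,i},0)$ with weight $1$, then $\lim_{k\to\infty}L_{S^{(k)}}(z)=L_S(z)$ and $\lim_{k\to\infty}G_{S^{(k)}}(z)=G_S(z)$ for every $z\in\mathbb D^2$.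
   Context: $\mathbb D$ is the open unit disc; $\phi_\xi(\zeta)=\frac{\xi-\zeta}{1-\bar\xi\zeta}$. $\Psi_m$ has Monge–Ampère mass $m$. For a system $T=\{(p_j,\Phi_j)\}$ of distinct points $p_j\in\mathbb D^2$ and indicators $\Phi_j$ with masses $\tau_j$ (for weight 1, $\Phi_j(w)=\max(\log|w_1|,\log|w_2|)$, $\tau_j=1$): $G_T(z)=\sup\{u(z):u$ negative plurisubharmonic on $\mathbb D^2$, $u(x)\le\Phi_j(x-p_j)+C_j$ near $p_j\}$, and $L_T(z)=\inf\{\sum_j\tau_j\log|\zeta_j|\}$ over holomorphic $\varphi:\mathbb D\to\mathbb D^2$ with $\varphi(0)=z$ and $\zeta_j\in\mathbb D$ such that $\Phi_j(\varphi(\zeta)-p_j)\le\tau_j\log|\zeta-\zeta_j|+C_j$ for $\zeta$ near $\zeta_j$. For weight-1 poles this is the usual Green function with logarithmic poles $\log\|x-p_j\|$ and Coman's Lempert function $\inf\{\sum_j\log|\zeta_j|:\varphi(0)=z,\varphi(\zeta_j)=p_j\}$. *)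

theory Defs
  imports "HOL-Analysis.Analysis"
begin

type_synonym c2 = "complex \<times> complex"

definition unit_disc :: "complex set" where
  "unit_disc = ball 0 1"

definition bidisc :: "c2 set" where
  "bidisc = {x. cmod (fst x) < 1 \<and> cmod (snd x) < 1}"

definition elog :: "complex \<Rightarrow> ereal" where
  "elog z = (if z = 0 then - \<infinity> else ereal (ln (cmod z)))"

definition moeb :: "complex \<Rightarrow> complex \<Rightarrow> complex" where
  "moeb \<xi> \<zeta> = (\<xi> - \<zeta>) / (1 - cnj \<xi> * \<zeta>)"

text \<open>Indicator Psi_m(w) = max(m log|w1|, log|w2|); its Monge-Ampere mass is m.
 For m = 1 this is the weight-1 indicator max(log|w1|, log|w2|).\<close>
definition Psi :: "nat \<Rightarrow> c2 \<Rightarrow> ereal" where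
  "Psi m w = max (ereal (real m) * elog (fst w)) (elog (snd w))"

definition cline :: "c2 \<Rightarrow> c2 \<Rightarrow> complex \<Rightarrow> c2" where
  "cline a b l = (fst a + l * fst b, snd a + l * snd b)"

definition usc_on :: "c2 set \<Rightarrow> (c2 \<Rightarrow> ereal) \<Rightarrow> bool" where
  "usc_on D u \<longleftrightarrow> (\<forall>c::real. openin (top_of_set D) {x\<in>D. u x < ereal c})"

text \<open>Negative plurisubharmonic functions on the bidisc: u < 0, upper semicontinuous,
 and satisfying the sub-mean value inequality on every closed complex disc
 {a + lambda b : |lambda| <= 1} contained in the bidisc.  Since u <= 0 the
 inequality u(a) <= (1/2pi) int_0^{2pi} u(a + e^{it} b) dt is written for the
 nonnegative function -u (as an ennreal-valued integral, allowing the value infinity).\<close>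
definition neg_psh :: "(c2 \<Rightarrow> ereal) \<Rightarrow> bool" where
  "neg_psh u \<longleftrightarrow>
     (\<forall>x\<in>bidisc. u x < 0) \<and> usc_on bidisc u \<and>
     (\<forall>a b. (\<forall>l. cmod l \<le> 1 \<longrightarrow> cline a b l \<in> bidisc) \<longrightarrow>
        ennreal (1 / (2 * pi)) *
          (\<integral>\<^sup>+ t. indicator {0..2*pi} t * e2ennreal (- u (cline a b (cis t))) \<partial>lborel)
        \<le> e2ennreal (- u a))"

text \<open>A pole system: finite index set I, distinct points p j in the bidisc, indicator
 Psi_(mu j) with mass mu j at p j.\<close>

definition has_poles :: "'i set \<Rightarrow> ('i \<Rightarrow> c2) \<Rightarrow> ('i \<Rightarrow> nat) \<Rightarrow> (c2 \<Rightarrow> ereal) \<Rightarrow> bool" where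
  "has_poles I p mu u \<longleftrightarrow>
     (\<forall>j\<in>I. \<exists>C::real. \<exists>\<epsilon>>0. \<forall>x\<in>bidisc. dist x (p j) < \<epsilon> \<longrightarrow>
        u x \<le> Psi (mu j) (x - p j) + ereal C)"

definition green :: "'i set \<Rightarrow> ('i \<Rightarrow> c2) \<Rightarrow> ('i \<Rightarrow> nat) \<Rightarrow> c2 \<Rightarrow> ereal" where
  "green I p mu z = Sup {u z | u. neg_psh u \<and> has_poles I p mu u}"

definition holo_disc :: "(complex \<Rightarrow> c2) \<Rightarrow> bool" where
  "holo_disc \<phi> \<longleftrightarrow> (fst \<circ> \<phi>) holomorphic_on unit_disc \<and> (snd \<circ> \<phi>) holomorphic_on unit_disc
      \<and> \<phi> ` unit_disc \<subseteq> bidisc"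

definition lempert :: "'i set \<Rightarrow> ('i \<Rightarrow> c2) \<Rightarrow> ('i \<Rightarrow> nat) \<Rightarrow> c2 \<Rightarrow> ereal" where
  "lempert I p mu z = Inf {(\<Sum>j\<in>I. ereal (real (mu j)) * elog (\<zeta> j)) | \<phi> \<zeta>.
      holo_disc \<phi> \<and> \<phi> 0 = z \<and>
      (\<forall>j\<in>I. \<zeta> j \<in> unit_disc \<and>
         (\<exists>C::real. \<exists>\<epsilon>>0. \<forall>t\<in>unit_disc. dist t (\<zeta> j) < \<epsilon> \<longrightarrow>
            Psi (mu j) (\<phi> t - p j) \<le> ereal (real (mu j)) * elog (t - \<zeta> j) + ereal C))}"

end

theory Submission
  imports Defs "HOL-Complex_Analysis.Riemann_Mapping" "HOL-Real_Asymp.Real_Asymp"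
begin

text \<open>Write \<open>B\<close> for the finite Blaschke product with a zero of order \<open>m\<^sub>j\<close> at \<open>a\<^sub>j\<close> and
  \<open>P(z) = max (log \<bar>B(z\<^sub>1)\<bar>) (log \<bar>z\<^sub>2\<bar>)\<close>. The equalities follow from the cycle \<open>P \<le> G \<le> L \<le> P\<close>, and
  the convergence then from the continuity of \<open>P\<close> in the zeros of \<open>B\<close>.

  \<open>P \<le> G\<close>: \<open>P\<close> competes for \<open>G\<close>; its sub-mean value inequality is Jensen's formula for a single
  Moebius factor.

  \<open>G \<le> L\<close>: plurisubharmonicity is given on complex lines only, so \<open>u \<circ> \<phi>\<close> is compared with
  \<open>H = (1 - \<epsilon>) log \<bar>f\<bar> + \<epsilon>\<close>, \<open>f\<close> the Blaschke product of the \<open>\<zeta>\<^sub>j\<close>, by maximising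
  \<open>u(w) - H(t) - L \<bar>w - \<phi>(t)\<bar>\<^sup>2 + \<eta> \<bar>t\<bar>\<^sup>2\<close> over a tube around the graph of \<open>\<phi>\<close>. At an interior maximum
  the small disc through \<open>w\<close> in the direction \<open>\<phi>'(t)\<close> contradicts the sub-mean value inequality:
  up to a holomorphic real part, the penalty changes by \<open>o(r\<^sup>2)\<close> while the last term gains \<open>\<eta> r\<^sup>2\<close>.

  \<open>L \<le> P\<close>: if \<open>\<bar>z\<^sub>2\<bar> \<le> \<bar>B(z\<^sub>1)\<bar>\<close>, a graph \<open>w\<^sub>2 = c B(w\<^sub>1)\<close> is an optimal disc. Otherwise the first
  component is precomposed with a self-map of the disc built from squarings and
  \<open>\<lambda> \<mapsto> \<lambda> \<phi>\<^sub>c(\<lambda>)\<close>; the intermediate value theorem in \<open>c\<close> makes the product of the moduli of the chosen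
  preimages equal to \<open>\<bar>z\<^sub>2\<bar>\<close>.\<close>

section \<open>Circle means of logarithms\<close>

text \<open>Cauchy's formula at the centre: on the unit circle the differential is
  \<open>\<i> * cis t\<close> dt, which cancels the denominator.\<close>

lemma holomorphic_circle_mean:
  fixes f :: "complex \<Rightarrow> complex"
  assumes "f holomorphic_on cball 0 1"
  shows "((\<lambda>t. f (cis t)) has_integral (2 * pi * f 0)) {0..2*pi}"
proof -
  have "((\<lambda>u. f u / (u - 0)) has_contour_integral (2 * of_real pi * \<i> * f 0)) (circlepath 0 1)"
    using assms by (intro Cauchy_integral_circlepath_simple) auto
  then have "((\<lambda>t. f (0 + of_real 1 * cis t) / (0 + of_real 1 * cis t - 0) * of_real 1 * \<i> * cis t)
      has_integral (2 * of_real pi * \<i> * f 0)) {0..2*pi}"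
    unfolding circlepath_def
    by (subst (asm) has_contour_integral_part_circlepath_iff) auto
  then have "((\<lambda>t. \<i> * f (cis t)) has_integral (2 * of_real pi * \<i> * f 0)) {0..2*pi}"
    by (rule has_integral_eq[rotated]) simp
  from has_integral_mult_right[OF this, of "- \<i>"] show ?thesis
    by (simp add: mult.assoc[symmetric]) (simp add: mult.commute mult.left_commute)
qed

lemma Re_holomorphic_circle_mean:
  assumes "f holomorphic_on cball 0 1"
  shows "((\<lambda>t. Re (f (cis t))) has_integral (2 * pi * Re (f 0))) {0..2*pi}"
  using has_integral_Re[OF holomorphic_circle_mean[OF assms]] by simp

text \<open>\<open>neg_psh\<close> is phrased with the nonnegative integral, whereas mean values of
  harmonic functions are signed. Truncation by \<open>ennreal\<close> replaces \<open>g\<close> by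
  its positive part, which can only increase the integral.\<close>

lemma has_integral_le_nn_integral:
  fixes g :: "real \<Rightarrow> real"
  assumes "(g has_integral I) {a..b}" "continuous_on {a..b} g"
  shows "ennreal I \<le> (\<integral>\<^sup>+ t. indicator {a..b} t * ennreal (g t) \<partial>lborel)"
proof -
  have c: "continuous_on {a..b} (\<lambda>t. max 0 (g t))"
    by (intro continuous_intros assms)
  then obtain J where J: "((\<lambda>t. max 0 (g t)) has_integral J) {a..b}"
    using integrable_continuous_real by blast
  have "I \<le> J"
    by (rule has_integral_le[OF assms(1) J]) auto
  moreover have "(\<integral>\<^sup>+ t. ennreal (max 0 (g t)) * indicator {a..b} t \<partial>lborel) = ennreal J"
    by (rule nn_integral_has_integral_lebesgue'[OF _ J]) auto
  moreover have "ennreal (max 0 x) = ennreal x" for x :: real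
    by (cases "x \<ge> 0") (auto simp: max_def ennreal_neg)
  ultimately show ?thesis by (simp add: mult.commute ennreal_leI)
qed

text \<open>\<open>1 - \<nu> * z\<close> has positive real part on the closed disc, so its principal
  logarithm is holomorphic there and the mean value is \<open>Re (Ln 1) = 0\<close>.\<close>

lemma ln_circle_mean:
  assumes "cmod \<nu> < 1"
  shows "((\<lambda>t. ln (cmod (1 - \<nu> * cis t))) has_integral 0) {0..2*pi}"
proof -
  have *: "Re (1 - \<nu> * z) > 0" if "z \<in> cball 0 1" for z
  proof -
    have "Re (\<nu> * z) \<le> cmod (\<nu> * z)" by (rule complex_Re_le_cmod)
    also have "\<dots> \<le> cmod \<nu>"
      using that by (simp add: norm_mult mult_left_le)
    finally show ?thesis using assms by simp
  qed
  have "(\<lambda>z. Ln (1 - \<nu> * z)) holomorphic_on cball 0 1"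
    using * by (intro holomorphic_intros) (force simp: complex_nonpos_Reals_iff)+
  from Re_holomorphic_circle_mean[OF this] have
    "((\<lambda>t. Re (Ln (1 - \<nu> * cis t))) has_integral 0) {0..2*pi}" by simp
  moreover have "Re (Ln (1 - \<nu> * cis t)) = ln (cmod (1 - \<nu> * cis t))" for t
  proof -
    have "cis t \<in> cball 0 1" by simp
    from *[OF this] have "1 - \<nu> * cis t \<noteq> 0" by (intro notI) (simp only: zero_complex.sel)
    then show ?thesis by (rule Re_Ln)
  qed
  ultimately show ?thesis by simp
qed

text \<open>Jensen's formula in degree one: factoring out the dominant coefficient reduces it to
  \<open>ln_circle_mean\<close>. Equal moduli are excluded since a zero would then lie on the
  circle.\<close>

lemma ln_affine_circle_mean:
  assumes "cmod \<alpha> \<noteq> cmod \<beta>"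
  shows "((\<lambda>t. ln (cmod (\<alpha> - \<beta> * cis t))) has_integral 2 * pi * ln (max (cmod \<alpha>) (cmod \<beta>))) {0..2*pi}"
proof -
  have main: "((\<lambda>t. ln (cmod (\<alpha> - \<beta> * cis t))) has_integral 2 * pi * ln (cmod \<alpha>)) {0..2*pi}"
    if "cmod \<beta> < cmod \<alpha>" for \<alpha> \<beta>
  proof -
    have nz: "\<alpha> \<noteq> 0" using that by auto
    have l: "cmod (\<beta>/\<alpha>) < 1" using that nz by (simp add: norm_divide divide_less_eq)
    have "ln (cmod (\<alpha> - \<beta> * cis t)) = ln (cmod \<alpha>) + ln (cmod (1 - (\<beta>/\<alpha>) * cis t))" for t
    proof -
      have "\<alpha> - \<beta> * cis t = \<alpha> * (1 - (\<beta>/\<alpha>) * cis t)" using nz by (simp add: field_simps)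
      moreover have "1 - (\<beta>/\<alpha>) * cis t \<noteq> 0"
      proof
        assume "1 - (\<beta>/\<alpha>) * cis t = 0"
        then have "1 = (\<beta>/\<alpha>) * cis t" by (simp only: right_minus_eq)
        then have "(\<beta>/\<alpha>) * cis t = 1" by (rule sym)
        then have "cmod ((\<beta>/\<alpha>) * cis t) = 1" by (simp only: norm_one)
        then show False using l by (simp only: norm_mult norm_cis mult_1_right)
      qed
      ultimately show ?thesis using nz by (simp add: norm_mult ln_mult)
    qed
    moreover have "((\<lambda>t. ln (cmod \<alpha>) + ln (cmod (1 - (\<beta>/\<alpha>) * cis t))) has_integral (2*pi - 0) *\<^sub>R ln (cmod \<alpha>) + 0) {0..2*pi}"
      by (intro has_integral_add ln_circle_mean[OF l]) (use has_integral_const_real[of "ln (cmod \<alpha>)" 0 "2*pi"] in auto)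
    ultimately show ?thesis by simp
  qed
  \<comment> \<open>\<open>\<bar>\<alpha> - \<beta> w\<bar>\<close> is symmetric in \<open>\<bar>\<alpha>\<bar>, \<bar>\<beta>\<bar>\<close> on the circle, by reflection.\<close>
  show ?thesis
  proof (cases "cmod \<beta> < cmod \<alpha>")
    case True
    then show ?thesis using main[OF True] by (simp add: max_def)
  next
    case False
    then have l: "cmod (cnj \<alpha>) < cmod (cnj \<beta>)" using assms by simp
    have "cmod (\<alpha> - \<beta> * cis t) = cmod (cnj \<beta> - cnj \<alpha> * cis t)" for t
    proof -
      have "cnj (cis t) * cis t = 1" by (simp add: cis_cnj cis_mult)
      then have "cnj (\<alpha> - \<beta> * cis t) * cis t = - (cnj \<beta> - cnj \<alpha> * cis t)"
        by (simp add: left_diff_distrib mult.assoc)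
      then show ?thesis
        by (metis complex_mod_cnj mult.right_neutral norm_cis norm_minus_cancel norm_mult)
    qed
    then show ?thesis using main[OF l] False by (simp add: max_def)
  qed
qed

section \<open>Extended logarithms and Moebius factors\<close>

text \<open>Plays the part of -log|z| in the \<open>ennreal\<close> integrals of
  \<open>neg_psh\<close>. As \<open>e2ennreal\<close> truncates negative values to 0, the product
  rules below ask for factors of modulus at most 1.\<close>

definition nlog :: "complex \<Rightarrow> ennreal" where
  "nlog z = e2ennreal (- elog z)"

lemma nlog_eq: "nlog z = (if z = 0 then \<infinity> else ennreal (- ln (cmod z)))"
  by (simp add: nlog_def elog_def e2ennreal_ereal)

lemma elog_mult: "elog (x * y) = elog x + elog y"
  by (auto simp: elog_def norm_mult ln_mult)

lemma elog_1 [simp]: "elog 1 = 0"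
  by (simp add: elog_def)

lemma elog_0 [simp]: "elog 0 = -\<infinity>"
  by (simp add: elog_def)

lemma elog_neg: "cmod x < 1 \<Longrightarrow> elog x < 0"
  by (auto simp: elog_def)

lemma elog_le_iff: "elog x \<le> elog y \<longleftrightarrow> cmod x \<le> cmod y"
  by (auto simp: elog_def)

lemma elog_less_iff: "elog x < ereal c \<longleftrightarrow> cmod x < exp c"
proof (cases "x = 0")
  case False
  then have "ln (cmod x) < c \<longleftrightarrow> cmod x < exp c"
    by (metis exp_less_cancel_iff exp_ln zero_less_norm_iff)
  with False show ?thesis by (simp add: elog_def)
qed simp

lemma elog_power: "elog (x ^ n) = ereal (real n) * elog x"
proof (cases "x = 0")
  case False
  then show ?thesis by (simp add: elog_def norm_power ln_realpow)
qed (cases "n = 0"; auto simp: elog_def)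

lemma elog_prod: "finite I \<Longrightarrow> elog (\<Prod>i\<in>I. f i) = (\<Sum>i\<in>I. elog (f i))"
  by (induction I rule: finite_induct) (auto simp: elog_mult)

lemma elog_prod_power:
  "finite I \<Longrightarrow> elog (\<Prod>i\<in>I. f i ^ mu i) = (\<Sum>i\<in>I. ereal (real (mu i)) * elog (f i))"
  by (simp add: elog_prod elog_power)

text \<open>The value -\<infinity> at 0 makes \<open>elog\<close> continuous on the whole plane as
  an \<open>ereal\<close> function, so limits at zeros need no separate treatment later.\<close>

lemma tendsto_elog:
  assumes "(f \<longlongrightarrow> l) F"
  shows "((\<lambda>x. elog (f x)) \<longlongrightarrow> elog l) F"
proof (cases "l = 0")
  case False
  have "((\<lambda>x. ereal (ln (cmod (f x)))) \<longlongrightarrow> ereal (ln (cmod l))) F"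
    using False by (intro tendsto_intros assms) auto
  moreover have "eventually (\<lambda>x. f x \<noteq> 0) F"
    using tendsto_imp_eventually_ne[OF assms False] .
  then have "eventually (\<lambda>x. ereal (ln (cmod (f x))) = elog (f x)) F"
    by eventually_elim (simp add: elog_def)
  ultimately show ?thesis using False by (auto simp: elog_def intro: Lim_transform_eventually)
next
  case True
  have "eventually (\<lambda>x. elog (f x) < ereal c) F" for c
    unfolding elog_less_iff
    using order_tendstoD(2)[OF tendsto_norm[OF assms], of "exp c"] True by simp
  then show ?thesis using True by (simp add: tendsto_MInfty)
qed

lemma continuous_on_elog: "continuous_on UNIV elog"
  unfolding continuous_on_def by (auto intro!: tendsto_elog tendsto_ident_at)

lemma elog_measurable [measurable]: "elog \<in> borel_measurable borel"
  by (rule borel_measurable_continuous_onI[OF continuous_on_elog])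

lemma nlog_measurable [measurable]: "nlog \<in> borel_measurable borel"
  unfolding nlog_def[abs_def] by measurable

lemma nlog_mult: "cmod x \<le> 1 \<Longrightarrow> cmod y \<le> 1 \<Longrightarrow> nlog (x * y) = nlog x + nlog y"
  by (auto simp: nlog_eq norm_mult ln_mult simp flip: ennreal_plus)

lemma cmod_prod_le_1: "(\<And>i. i \<in> I \<Longrightarrow> cmod (f i) \<le> 1) \<Longrightarrow> cmod (\<Prod>i\<in>I. f i) \<le> 1"
  by (simp add: prod_norm[symmetric] prod_le_1)

lemma nlog_power: "cmod x \<le> 1 \<Longrightarrow> nlog (x ^ n) = of_nat n * nlog x"
  by (induction n) (auto simp: nlog_mult norm_power power_le_one nlog_eq[of 1] distrib_right)

lemma nlog_prod:
  "finite I \<Longrightarrow> (\<And>i. i \<in> I \<Longrightarrow> cmod (f i) \<le> 1) \<Longrightarrow> nlog (\<Prod>i\<in>I. f i) = (\<Sum>i\<in>I. nlog (f i))"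
  by (induction I rule: finite_induct)
     (auto simp: nlog_mult cmod_prod_le_1 nlog_eq[of 1])

lemma tendsto_nlog: "(f \<longlongrightarrow> l) F \<Longrightarrow> ((\<lambda>x. nlog (f x)) \<longlongrightarrow> nlog l) F"
  unfolding nlog_def by (intro tendsto_e2ennrealI tendsto_uminus_ereal tendsto_elog)

lemma moeb_denom_nz:
  assumes "cmod a < 1" "cmod z \<le> 1"
  shows "1 - cnj a * z \<noteq> 0"
proof
  assume "1 - cnj a * z = 0"
  then have "cnj a * z = 1" by simp
  then have "cmod a * cmod z = 1" by (metis complex_mod_cnj norm_mult norm_one)
  moreover have "cmod a * cmod z \<le> cmod a" using assms by (simp add: mult_left_le)
  ultimately show False using assms by linarith
qed

lemma norm_affine_disc_less:
  assumes "\<And>l. cmod l \<le> 1 \<Longrightarrow> cmod (z + l * b) < 1"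
  shows "cmod z + cmod b < 1"
proof (cases "z = 0 \<or> b = 0")
  case True
  then show ?thesis using assms[of 1] assms[of 0] by auto
next
  case False
  \<comment> \<open>\<open>l\<close> turns \<open>b\<close> into the direction of \<open>z\<close>,
    so that the moduli add up.\<close>
  define l where "l = sgn z / sgn b"
  have "cmod l = 1" using False by (simp add: l_def norm_divide norm_sgn)
  moreover have "z + l * b = sgn z * of_real (cmod z + cmod b)"
  proof -
    have *: "x = sgn x * of_real (cmod x)" for x :: complex
      by (cases "x = 0") (simp_all add: sgn_eq)
    have "l * b = sgn z / sgn b * (sgn b * of_real (cmod b))"
      unfolding l_def by (subst (2) *[of b]) (rule refl)
    also have "\<dots> = sgn z * of_real (cmod b)" using False by (simp add: sgn_zero_iff)
    finally show ?thesis by (subst *[of z]) (simp add: distrib_left)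
  qed
  then have "cmod (z + l * b) = cmod z + cmod b"
    using False by (simp only: norm_mult norm_sgn norm_of_real) simp
  ultimately show ?thesis using assms[of l] by simp
qed

lemma moeb_eq_Moebius_function: "moeb a z = - Moebius_function 0 a z"
  by (simp add: moeb_def Moebius_function_simple minus_divide_left)

lemma moeb_norm_less: "cmod a < 1 \<Longrightarrow> cmod z < 1 \<Longrightarrow> cmod (moeb a z) < 1"
  by (simp add: moeb_eq_Moebius_function Moebius_function_norm_lt_1)

lemma moeb_in_unit_disc: "a \<in> unit_disc \<Longrightarrow> z \<in> unit_disc \<Longrightarrow> moeb a z \<in> unit_disc"
  using moeb_norm_less by (simp add: unit_disc_def)

lemma moeb_holomorphic: "a \<in> unit_disc \<Longrightarrow> moeb a holomorphic_on unit_disc"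
  unfolding moeb_def unit_disc_def
  by (intro holomorphic_intros) (use moeb_denom_nz in auto)

lemma moeb_moeb:
  assumes "a \<in> unit_disc" "z \<in> unit_disc"
  shows "moeb a (moeb a z) = z"
proof -
  have 1: "1 - cnj a * z \<noteq> 0" "1 - cnj a * a \<noteq> 0"
    using moeb_denom_nz[of a] assms by (auto simp: unit_disc_def)
  define p where "p = 1 - cnj a * z"
  have p: "p \<noteq> 0" "moeb a z = (a - z) / p" using 1 by (auto simp: p_def moeb_def)
  have "a - moeb a z = (a * p - (a - z)) / p"
    using p by (simp add: diff_divide_distrib right_diff_distrib)
  also have "a * p - (a - z) = z * (1 - cnj a * a)" by (simp add: p_def algebra_simps)
  finally have n: "a - moeb a z = z * (1 - cnj a * a) / p" .
  have "1 - cnj a * moeb a z = (p - cnj a * (a - z)) / p"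
    using p by (simp add: diff_divide_distrib right_diff_distrib)
  also have "p - cnj a * (a - z) = 1 - cnj a * a" by (simp add: p_def algebra_simps)
  finally have d: "1 - cnj a * moeb a z = (1 - cnj a * a) / p" .
  show ?thesis
    unfolding moeb_def[of a "moeb a z"] n d using 1 p by simp
qed

lemma moeb_0_right [simp]: "moeb a 0 = a"
  by (simp add: moeb_def)

lemma moeb_self [simp]: "moeb a a = 0"
  by (simp add: moeb_def)

lemma moeb_eq_0_iff: "a \<in> unit_disc \<Longrightarrow> z \<in> unit_disc \<Longrightarrow> moeb a z = 0 \<longleftrightarrow> z = a"
  using moeb_denom_nz[of a z] by (auto simp: moeb_def unit_disc_def)

lemma cmod_moeb_commute: "cmod (moeb a z) = cmod (moeb z a)"
proof -
  have "cmod (1 - cnj a * z) = cmod (cnj (1 - cnj a * z))" by (rule complex_mod_cnj[symmetric])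
  also have "\<dots> = cmod (1 - cnj z * a)" by (simp add: mult.commute)
  finally show ?thesis by (simp add: moeb_def norm_divide norm_minus_commute)
qed

section \<open>Sub-mean value inequality for one Moebius factor\<close>

lemma cis_measurable [measurable]: "cis \<in> borel_measurable borel"
  by (intro borel_measurable_continuous_onI continuous_intros)

lemma moeb_measurable [measurable]: "moeb a \<in> borel_measurable borel"
  unfolding moeb_def[abs_def] by measurable

text \<open>Numerator and denominator of \<open>moeb a (z + cis t * b)\<close> are both affine in
  \<open>cis t\<close>, so \<open>ln_affine_circle_mean\<close> applies to each. As |z| + |b| < 1,
  the constant term dominates in the denominator; for the numerator the maximum remains.\<close>

lemma nlog_moeb_circle:
  assumes a: "cmod a < 1" and b: "cmod z + cmod b < 1" and ne: "cmod (a - z) \<noteq> cmod b"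
  shows "(\<integral>\<^sup>+ t. indicator {0..2*pi} t * nlog (moeb a (z + cis t * b)) \<partial>lborel)
    = ennreal (2 * pi * (ln (cmod (1 - cnj a * z)) - ln (max (cmod (a - z)) (cmod b))))"
proof -
  have inD: "cmod (z + cis t * b) < 1" for t
    using norm_triangle_ineq[of z "cis t * b"] b by (simp add: norm_mult)
  have D: "cmod (cnj a * b) < cmod (1 - cnj a * z)"
  proof -
    have "cmod a * (cmod z + cmod b) < 1"
      using a b by (smt (verit) mult_left_le norm_ge_zero mult_nonneg_nonneg)
    moreover have "1 \<le> cmod (1 - cnj a * z) + cmod (cnj a * z)"
      using norm_triangle_ineq[of "1 - cnj a * z" "cnj a * z"] by simp
    ultimately show ?thesis by (simp add: norm_mult distrib_left)
  qed
  have i: "((\<lambda>t. ln (cmod (1 - cnj a * z - cnj a * b * cis t)) - ln (cmod (a - z - b * cis t)))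
    has_integral (2 * pi * ln (max (cmod (1 - cnj a * z)) (cmod (cnj a * b))) - 2 * pi * ln (max (cmod (a - z)) (cmod b)))) {0..2*pi}"
    using D ne by (intro has_integral_diff ln_affine_circle_mean) auto
  have eq: "ln (cmod (1 - cnj a * z - cnj a * b * cis t)) - ln (cmod (a - z - b * cis t))
     = - ln (cmod (moeb a (z + cis t * b)))" and nz: "moeb a (z + cis t * b) \<noteq> 0" for t
  proof -
    have 1: "1 - cnj a * z - cnj a * b * cis t = 1 - cnj a * (z + cis t * b)"
      "a - z - b * cis t = a - (z + cis t * b)"
      by (simp_all add: algebra_simps)
    have 2: "1 - cnj a * (z + cis t * b) \<noteq> 0"
      using moeb_denom_nz[OF a] inD[of t] by auto
    have 3: "a - (z + cis t * b) \<noteq> 0"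
    proof
      assume "a - (z + cis t * b) = 0"
      then have "a - z = cis t * b" by (simp add: algebra_simps)
      then show False using ne by (simp add: norm_mult)
    qed
    show "ln (cmod (1 - cnj a * z - cnj a * b * cis t)) - ln (cmod (a - z - b * cis t))
       = - ln (cmod (moeb a (z + cis t * b)))"
      unfolding 1 moeb_def using 2 3 by (simp add: norm_divide ln_div)
    show "moeb a (z + cis t * b) \<noteq> 0" unfolding moeb_def using 2 3 by simp
  qed
  have pos: "0 \<le> - ln (cmod (moeb a (z + cis t * b)))" for t
    using moeb_norm_less[OF a inD[of t]] nz[of t] by simp
  have "(\<integral>\<^sup>+ t. ennreal (- ln (cmod (moeb a (z + cis t * b)))) * indicator {0..2*pi} t \<partial>lborel)
    = ennreal (2 * pi * ln (max (cmod (1 - cnj a * z)) (cmod (cnj a * b))) - 2 * pi * ln (max (cmod (a - z)) (cmod b)))"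
    using i unfolding eq by (intro nn_integral_has_integral_lebesgue') (use pos in auto)
  moreover have "indicator {0..2*pi} t * nlog (moeb a (z + cis t * b))
      = ennreal (- ln (cmod (moeb a (z + cis t * b)))) * indicator {0..2*pi} t" for t
    using nz[of t] by (simp add: nlog_eq mult.commute)
  moreover have "max (cmod (1 - cnj a * z)) (cmod (cnj a * b)) = cmod (1 - cnj a * z)"
    using D by simp
  ultimately show ?thesis
    by (simp only: right_diff_distrib)
qed

text \<open>In the formula of \<open>nlog_moeb_circle\<close>, replacing the maximum by
  \<open>cmod (a - z)\<close> only increases the value, which settles the case of no zero on the
  circle. For z = a the right-hand side is infinite.\<close>

lemma nlog_moeb_submean:
  assumes a: "cmod a < 1" and b: "cmod z + cmod b < 1"
  shows "(\<integral>\<^sup>+ t. indicator {0..2*pi} t * nlog (moeb a (z + cis t * b)) \<partial>lborel)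
    \<le> ennreal (2 * pi) * nlog (moeb a z)"
proof (cases "z = a")
  case True
  then have "nlog (moeb a z) = top" by (simp add: nlog_eq)
  then show ?thesis by (simp add: ennreal_mult_top)
next
  case False
  have z1: "cmod z < 1" using b by (smt (verit) norm_ge_zero)
  have dz: "1 - cnj a * z \<noteq> 0" using moeb_denom_nz[OF a] z1 by auto
  have rhs: "nlog (moeb a z) = ennreal (ln (cmod (1 - cnj a * z)) - ln (cmod (a - z)))"
    using False dz by (simp add: nlog_eq moeb_def norm_divide ln_div)
  have rhs': "ennreal (2 * pi) * nlog (moeb a z)
      = ennreal (2 * pi * (ln (cmod (1 - cnj a * z)) - ln (cmod (a - z))))"
    unfolding rhs by (simp add: ennreal_mult')
  have ne_case: "(\<integral>\<^sup>+ t. indicator {0..2*pi} t * nlog (moeb a (z + cis t * b)) \<partial>lborel)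
    \<le> ennreal (2 * pi) * nlog (moeb a z)" if b: "cmod z + cmod b < 1" and ne: "cmod (a - z) \<noteq> cmod b" for b
    unfolding nlog_moeb_circle[OF a b ne] rhs'
    using False by (intro ennreal_leI mult_left_mono diff_left_mono ln_mono) auto
  \<comment> \<open>If the zero lies on the circle itself, shrink the circle and apply Fatou's lemma.\<close>
  show ?thesis
  proof (cases "cmod (a - z) = cmod b")
    case False
    then show ?thesis using ne_case b by blast
  next
    case True
    \<comment> \<open>The shift by 2 keeps \<open>r n\<close> strictly between 0 and 1 from n = 0
      on.\<close>
    define r where "r n = 1 - 1 / real (n + 2)" for n
    have r: "0 < r n" "r n < 1" for n by (auto simp: r_def)
    have rl: "r \<longlonglongrightarrow> 1" unfolding r_def by real_asymp
    have bnz: "b \<noteq> 0" using True \<open>z \<noteq> a\<close> by auto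
    have le: "(\<integral>\<^sup>+ t. indicator {0..2*pi} t * nlog (moeb a (z + cis t * (of_real (r n) * b))) \<partial>lborel)
      \<le> ennreal (2 * pi) * nlog (moeb a z)" for n
    proof (rule ne_case)
      have s: "cmod (of_real (r n) * b) < cmod b"
        using r[of n] bnz by (simp add: norm_mult)
      then show "cmod z + cmod (of_real (r n) * b) < 1" "cmod (a - z) \<noteq> cmod (of_real (r n) * b)"
        using b True by auto
    qed
    have lim: "(\<lambda>n. nlog (moeb a (z + cis t * (of_real (r n) * b)))) \<longlonglongrightarrow> nlog (moeb a (z + cis t * b))" for t
    proof (rule tendsto_nlog)
      have "cmod (z + cis t * b) < 1"
        using norm_triangle_ineq[of z "cis t * b"] b by (simp add: norm_mult)
      then have "1 - cnj a * (z + cis t * b) \<noteq> 0" using moeb_denom_nz[OF a] by auto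
      moreover have "(\<lambda>n. z + cis t * (of_real (r n) * b)) \<longlonglongrightarrow> z + cis t * (of_real 1 * b)"
        by (intro tendsto_intros rl)
      then have "(\<lambda>n. z + cis t * (of_real (r n) * b)) \<longlonglongrightarrow> z + cis t * b" by simp
      ultimately show "(\<lambda>n. moeb a (z + cis t * (of_real (r n) * b))) \<longlonglongrightarrow> moeb a (z + cis t * b)"
        unfolding moeb_def by (intro tendsto_divide tendsto_diff tendsto_mult tendsto_const)
    qed
    have "(\<integral>\<^sup>+ t. indicator {0..2*pi} t * nlog (moeb a (z + cis t * b)) \<partial>lborel)
      = (\<integral>\<^sup>+ t. liminf (\<lambda>n. indicator {0..2*pi} t * nlog (moeb a (z + cis t * (of_real (r n) * b)))) \<partial>lborel)"
    proof (rule nn_integral_cong)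
      fix t
      have "(\<lambda>n. indicator {0..2*pi} t * nlog (moeb a (z + cis t * (of_real (r n) * b)))) \<longlonglongrightarrow>
        indicator {0..2*pi} t * nlog (moeb a (z + cis t * b))"
        using lim[of t] by (cases "t \<in> {0..2*pi}") simp_all
      from lim_imp_Liminf[OF sequentially_bot this]
      show "indicator {0..2*pi} t * nlog (moeb a (z + cis t * b))
        = liminf (\<lambda>n. indicator {0..2*pi} t * nlog (moeb a (z + cis t * (of_real (r n) * b))))" by simp
    qed
    also have "\<dots> \<le> liminf (\<lambda>n. \<integral>\<^sup>+ t. indicator {0..2*pi} t * nlog (moeb a (z + cis t * (of_real (r n) * b))) \<partial>lborel)"
      by (rule nn_integral_liminf) measurable
    also have "\<dots> \<le> ennreal (2 * pi) * nlog (moeb a z)"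
      using le by (intro Liminf_le[OF sequentially_bot] always_eventually allI)
    finally show ?thesis .
  qed
qed

section \<open>The explicit competitor for the Green function\<close>

text \<open>Used with two kinds of zeros: the first coordinates \<open>a\<close> of the poles,
  giving the explicit formula, and the parameters \<zeta> of an analytic disc, where the modulus at
  0 gives the quantity minimised by \<open>lempert\<close>. An empty \<open>I\<close> yields the
  constant 1.\<close>

definition fin_blaschke :: "'i set \<Rightarrow> ('i \<Rightarrow> complex) \<Rightarrow> ('i \<Rightarrow> nat) \<Rightarrow> complex \<Rightarrow> complex" where
  "fin_blaschke I a mu w = (\<Prod>i\<in>I. moeb (a i) w ^ mu i)"

lemma elog_fin_blaschke:
  "finite I \<Longrightarrow> elog (fin_blaschke I a mu w) = (\<Sum>i\<in>I. ereal (real (mu i)) * elog (moeb (a i) w))"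
  unfolding fin_blaschke_def by (rule elog_prod_power)

lemma fin_blaschke_0 [simp]: "fin_blaschke I a mu 0 = (\<Prod>i\<in>I. a i ^ mu i)"
  by (simp add: fin_blaschke_def)

lemma norm_fin_blaschke_le:
  assumes "\<forall>i\<in>I. a i \<in> unit_disc" "w \<in> unit_disc"
  shows "cmod (fin_blaschke I a mu w) \<le> 1"
  unfolding fin_blaschke_def using assms moeb_norm_less
  by (intro cmod_prod_le_1) (auto simp: norm_power unit_disc_def less_imp_le intro!: power_le_one)

lemma norm_fin_blaschke_le_factor:
  assumes "finite I" "\<forall>i\<in>I. a i \<in> unit_disc" "w \<in> unit_disc" "j \<in> I"
  shows "cmod (fin_blaschke I a mu w) \<le> cmod (moeb (a j) w) ^ mu j"
proof -
  have "fin_blaschke I a mu w = moeb (a j) w ^ mu j * fin_blaschke (I - {j}) a mu w"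
    unfolding fin_blaschke_def using assms by (simp add: prod.remove)
  then show ?thesis
    using norm_fin_blaschke_le[of "I - {j}" a w mu] assms
    by (simp add: norm_mult norm_power mult_left_le)
qed

lemma norm_fin_blaschke_less:
  assumes "finite I" "\<forall>i\<in>I. a i \<in> unit_disc" "w \<in> unit_disc" "I \<noteq> {}" "\<forall>i\<in>I. mu i \<ge> 1"
  shows "cmod (fin_blaschke I a mu w) < 1"
proof -
  obtain j where j: "j \<in> I" using assms by blast
  have "cmod (fin_blaschke I a mu w) \<le> cmod (moeb (a j) w) ^ mu j"
    using assms j by (intro norm_fin_blaschke_le_factor) auto
  also have "\<dots> < 1"
    using assms j moeb_norm_less by (intro power_less_one_iff[THEN iffD2]) (auto simp: unit_disc_def power_less_one_iff Suc_le_eq)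
  finally show ?thesis .
qed

lemma fin_blaschke_eq_0_iff:
  assumes "finite I" "\<forall>i\<in>I. a i \<in> unit_disc" "w \<in> unit_disc" "\<forall>i\<in>I. mu i \<ge> 1"
  shows "fin_blaschke I a mu w = 0 \<longleftrightarrow> w \<in> a ` I"
  using assms moeb_eq_0_iff by (fastforce simp: fin_blaschke_def)

lemma fin_blaschke_holomorphic:
  assumes "\<forall>i\<in>I. a i \<in> unit_disc"
  shows "fin_blaschke I a mu holomorphic_on unit_disc"
  unfolding fin_blaschke_def
  by (intro holomorphic_on_prod holomorphic_on_power) (use assms moeb_holomorphic in auto)

lemma nlog_fin_blaschke:
  assumes "finite I" "\<forall>i\<in>I. a i \<in> unit_disc" "w \<in> unit_disc"
  shows "nlog (fin_blaschke I a mu w) = (\<Sum>i\<in>I. of_nat (mu i) * nlog (moeb (a i) w))"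
proof -
  have *: "cmod (moeb (a i) w) \<le> 1" if "i \<in> I" for i
    using assms that moeb_norm_less by (auto simp: unit_disc_def less_imp_le)
  have "nlog (fin_blaschke I a mu w) = (\<Sum>i\<in>I. nlog (moeb (a i) w ^ mu i))"
    unfolding fin_blaschke_def using *
    by (intro nlog_prod assms) (auto simp: norm_power power_le_one)
  also have "\<dots> = (\<Sum>i\<in>I. of_nat (mu i) * nlog (moeb (a i) w))"
    using * by (intro sum.cong refl nlog_power) auto
  finally show ?thesis .
qed

text \<open>\<open>nlog\<close> is additive over the factors, so this is the weighted sum of the
  inequalities for single factors.\<close>

lemma nlog_fin_blaschke_submean:
  assumes I: "finite I" and a: "\<forall>i\<in>I. a i \<in> unit_disc" and zb: "cmod z + cmod b < 1"
  shows "(\<integral>\<^sup>+ t. indicator {0..2*pi} t * nlog (fin_blaschke I a mu (z + cis t * b)) \<partial>lborel)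
    \<le> ennreal (2 * pi) * nlog (fin_blaschke I a mu z)"
proof -
  have D: "z + cis t * b \<in> unit_disc" for t
    using norm_triangle_ineq[of z "cis t * b"] zb by (simp add: norm_mult unit_disc_def)
  have z: "z \<in> unit_disc" using zb by (simp add: unit_disc_def) (smt (verit) norm_ge_zero)
  have "(\<integral>\<^sup>+ t. indicator {0..2*pi} t * nlog (fin_blaschke I a mu (z + cis t * b)) \<partial>lborel)
    = (\<integral>\<^sup>+ t. (\<Sum>i\<in>I. of_nat (mu i) * (indicator {0..2*pi} t * nlog (moeb (a i) (z + cis t * b)))) \<partial>lborel)"
    unfolding nlog_fin_blaschke[OF I a D] by (simp add: sum_distrib_left mult.left_commute)
  also have "\<dots> = (\<Sum>i\<in>I. of_nat (mu i) * (\<integral>\<^sup>+ t. indicator {0..2*pi} t * nlog (moeb (a i) (z + cis t * b)) \<partial>lborel))"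
    by (subst nn_integral_sum) (auto intro!: sum.cong nn_integral_cmult)
  also have "\<dots> \<le> (\<Sum>i\<in>I. of_nat (mu i) * (ennreal (2 * pi) * nlog (moeb (a i) z)))"
    using a zb by (intro sum_mono mult_left_mono nlog_moeb_submean) (auto simp: unit_disc_def)
  also have "\<dots> = ennreal (2 * pi) * nlog (fin_blaschke I a mu z)"
    unfolding nlog_fin_blaschke[OF I a z] by (simp add: sum_distrib_left mult.left_commute)
  finally show ?thesis .
qed

lemma cline_in_bidisc_D:
  assumes "\<forall>l. cmod l \<le> 1 \<longrightarrow> cline x b l \<in> bidisc"
  shows "cmod (fst x) + cmod (fst b) < 1" "cmod (snd x) + cmod (snd b) < 1"
  by (rule norm_affine_disc_less; use assms in \<open>auto simp: cline_def bidisc_def\<close>)+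

definition pole_fun :: "'i set \<Rightarrow> ('i \<Rightarrow> complex) \<Rightarrow> ('i \<Rightarrow> nat) \<Rightarrow> c2 \<Rightarrow> ereal" where
  "pole_fun I a mu x = max (elog (fin_blaschke I a mu (fst x))) (elog (snd x))"

text \<open>\<open>e2ennreal\<close> of the negated maximum is the smaller of two
  \<open>nlog\<close> values: on the circle it lies below both, at the centre it equals one of them,
  and the sub-mean inequality of that one suffices. \<open>I \<noteq> {}\<close> makes the Blaschke
  part strictly negative.\<close>

lemma neg_psh_pole_fun:
  assumes I: "finite I" "I \<noteq> {}" and a: "\<forall>i\<in>I. a i \<in> unit_disc" and mu: "\<forall>i\<in>I. mu i \<ge> 1"
  shows "neg_psh (pole_fun I a mu)"
proof -
  have neg: "pole_fun I a mu x < 0" if "x \<in> bidisc" for x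
    using that norm_fin_blaschke_less[of I a "fst x" mu] assms
    by (auto simp: pole_fun_def bidisc_def unit_disc_def intro!: elog_neg)
  have usc: "usc_on bidisc (pole_fun I a mu)"
    unfolding usc_on_def
  proof
    fix c :: real
    have c1: "continuous_on unit_disc (fin_blaschke I a mu)"
      using fin_blaschke_holomorphic[OF a] holomorphic_on_imp_continuous_on by blast
    have "continuous_on bidisc (\<lambda>x. fin_blaschke I a mu (fst x))"
      by (rule continuous_on_compose2[OF c1]) (auto intro!: continuous_intros simp: bidisc_def unit_disc_def)
    then have "continuous_on bidisc (\<lambda>x. max (cmod (fin_blaschke I a mu (fst x))) (cmod (snd x)))"
      by (intro continuous_intros)
    from continuous_openin_preimage_gen[OF this open_lessThan[of "exp c"]]
    have "openin (top_of_set bidisc) (bidisc \<inter> (\<lambda>x. max (cmod (fin_blaschke I a mu (fst x))) (cmod (snd x))) -` {..<exp c})" .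
    also have "bidisc \<inter> (\<lambda>x. max (cmod (fin_blaschke I a mu (fst x))) (cmod (snd x))) -` {..<exp c}
      = {x \<in> bidisc. pole_fun I a mu x < ereal c}"
      by (auto simp: pole_fun_def elog_less_iff)
    finally show "openin (top_of_set bidisc) {x \<in> bidisc. pole_fun I a mu x < ereal c}" .
  qed
  have mean: "ennreal (1 / (2 * pi)) * (\<integral>\<^sup>+ t. indicator {0..2*pi} t * e2ennreal (- pole_fun I a mu (cline x b (cis t))) \<partial>lborel)
        \<le> e2ennreal (- pole_fun I a mu x)"
    if "\<forall>l. cmod l \<le> 1 \<longrightarrow> cline x b l \<in> bidisc" for x b
  proof -
    let ?J = "\<integral>\<^sup>+ t. indicator {0..2*pi} t * e2ennreal (- pole_fun I a mu (cline x b (cis t))) \<partial>lborel"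
    note D = cline_in_bidisc_D[OF that]
    have "?J \<le> (\<integral>\<^sup>+ t. indicator {0..2*pi} t * nlog (fin_blaschke I a mu (fst x + cis t * fst b)) \<partial>lborel)"
      unfolding nlog_def
      by (intro nn_integral_mono mult_left_mono e2ennreal_mono) (auto simp: pole_fun_def cline_def)
    also have "\<dots> \<le> ennreal (2 * pi) * nlog (fin_blaschke I a mu (fst x))"
      using D by (intro nlog_fin_blaschke_submean I a)
    finally have 1: "?J \<le> ennreal (2 * pi) * nlog (fin_blaschke I a mu (fst x))" .
    \<comment> \<open>Up to sign, the second coordinate is the Moebius factor with zero at
      0.\<close>
    have n0: "nlog (moeb 0 w) = nlog w" for w by (simp add: moeb_def nlog_eq)
    have "?J \<le> (\<integral>\<^sup>+ t. indicator {0..2*pi} t * nlog (snd x + cis t * snd b) \<partial>lborel)"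
      unfolding nlog_def
      by (intro nn_integral_mono mult_left_mono e2ennreal_mono) (auto simp: pole_fun_def cline_def)
    also have "\<dots> \<le> ennreal (2 * pi) * nlog (snd x)"
      using nlog_moeb_submean[of 0 "snd x" "snd b"] D by (simp add: n0)
    finally have 2: "?J \<le> ennreal (2 * pi) * nlog (snd x)" .
    have "e2ennreal (- pole_fun I a mu x) = nlog (fin_blaschke I a mu (fst x)) \<or>
        e2ennreal (- pole_fun I a mu x) = nlog (snd x)"
      by (auto simp: pole_fun_def max_def nlog_def)
    then have "?J \<le> ennreal (2 * pi) * e2ennreal (- pole_fun I a mu x)"
      using 1 2 by auto
    then have "ennreal (1 / (2 * pi)) * ?J \<le> ennreal (1 / (2 * pi)) * (ennreal (2 * pi) * e2ennreal (- pole_fun I a mu x))"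
      by (intro mult_left_mono) auto
    also have "\<dots> = e2ennreal (- pole_fun I a mu x)"
      by (simp add: mult.assoc[symmetric] ennreal_mult[symmetric])
    finally show ?thesis .
  qed
  show ?thesis unfolding neg_psh_def using neg usc mean by blast
qed

text \<open>All factors but the \<open>j\<close>-th have modulus at most 1, and the denominator of
  that one is at least \<open>1 - cmod (a j)\<close>. Besides the poles of \<open>pole_fun\<close>
  this gives the contact order of the discs constructed later.\<close>

lemma elog_fin_blaschke_le:
  assumes I: "finite I" "j \<in> I" and a: "\<forall>i\<in>I. a i \<in> unit_disc" and w: "w \<in> unit_disc"
  shows "elog (fin_blaschke I a mu w)
    \<le> ereal (real (mu j)) * elog (w - a j) + ereal (real (mu j) * ln (1 / (1 - cmod (a j))))"
proof -
  have p: "cmod (a j) < 1" using I a by (auto simp: unit_disc_def)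
  define q where "q = of_real (1 / (1 - cmod (a j))) * (w - a j)"
  have "1 - cmod (a j) \<le> cmod (1 - cnj (a j) * w)"
  proof -
    have "cmod (cnj (a j) * w) \<le> cmod (a j)"
      using w by (simp add: norm_mult unit_disc_def mult_left_le)
    then show ?thesis using norm_triangle_ineq2[of 1 "cnj (a j) * w"] by simp
  qed
  then have "cmod (moeb (a j) w) \<le> cmod q"
  proof -
    have "cmod (of_real (1 / (1 - cmod (a j))) :: complex) = 1 / (1 - cmod (a j))"
      unfolding norm_of_real using p by simp
    then have "cmod q = cmod (w - a j) / (1 - cmod (a j))" unfolding q_def norm_mult by simp
    with \<open>1 - cmod (a j) \<le> _\<close> p show ?thesis
      by (simp add: moeb_def norm_divide norm_minus_commute frac_le)
  qed
  moreover have "cmod (fin_blaschke I a mu w) \<le> cmod (moeb (a j) w) ^ mu j"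
    using assms by (intro norm_fin_blaschke_le_factor)
  ultimately have "cmod (fin_blaschke I a mu w) \<le> cmod (q ^ mu j)"
    by (simp add: norm_power) (meson norm_ge_zero order_trans power_mono)
  then have "elog (fin_blaschke I a mu w) \<le> elog (q ^ mu j)" by (simp add: elog_le_iff)
  also have "\<dots> = ereal (real (mu j)) * elog (w - a j) + ereal (real (mu j) * ln (1 / (1 - cmod (a j))))"
  proof -
    have "elog (of_real (1 / (1 - cmod (a j)))) = ereal (ln (1 / (1 - cmod (a j))))"
      unfolding elog_def norm_of_real using p by simp
    then show ?thesis
      unfolding elog_power unfolding q_def elog_mult
      by (simp add: ereal_right_distrib elog_def algebra_simps)
  qed
  finally show ?thesis .
qed

lemma has_poles_pole_fun:
  assumes I: "finite I" and a: "\<forall>i\<in>I. a i \<in> unit_disc"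
  shows "has_poles I (\<lambda>i. (a i, 0)) mu (pole_fun I a mu)"
  unfolding has_poles_def
proof
  fix j assume j: "j \<in> I"
  define C where "C = real (mu j) * ln (1 / (1 - cmod (a j)))"
  have "C \<ge> 0" using a j by (auto simp: C_def unit_disc_def intro!: mult_nonneg_nonneg ln_ge_zero)
  \<comment> \<open>The bound holds on the whole bidisc, so the radius 1 chosen at the end is
    arbitrary.\<close>
  have "pole_fun I a mu x \<le> Psi (mu j) (x - (a j, 0)) + ereal C" if "x \<in> bidisc" for x
  proof -
    have "elog (fin_blaschke I a mu (fst x)) \<le> ereal (real (mu j)) * elog (fst x - a j) + ereal C"
      unfolding C_def using that
      by (intro elog_fin_blaschke_le I j a) (auto simp: bidisc_def unit_disc_def)
    moreover have "elog (snd x) \<le> elog (snd x) + ereal C"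
      using \<open>C \<ge> 0\<close> by (simp add: add_increasing2)
    ultimately show ?thesis
      unfolding pole_fun_def Psi_def
      by (intro max.boundedI; elim order_trans; intro add_right_mono) auto
  qed
  then show "\<exists>C. \<exists>\<epsilon>>0. \<forall>x\<in>bidisc. dist x (a j, 0) < \<epsilon> \<longrightarrow> pole_fun I a mu x \<le> Psi (mu j) (x - (a j, 0)) + ereal C"
    by (intro exI[of _ C] exI[of _ 1]) auto
qed

text \<open>Serves the empty pole system: there \<open>pole_fun\<close> is 0 on the bidisc and fails
  strict negativity, so the lower bound 0 for the Green function comes from the constants
  \<open>- e\<close>.\<close>

lemma neg_psh_const:
  assumes "e > 0"
  shows "neg_psh (\<lambda>_. ereal (- e))"
proof -
  have "ennreal (1 / (2 * pi)) * (\<integral>\<^sup>+ t. indicator {0..2*pi} t * e2ennreal (ereal e) \<partial>lborel) = e2ennreal (ereal e)"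
    by (simp add: nn_integral_multc mult.assoc[symmetric] ennreal_mult[symmetric])
  moreover have "{x \<in> bidisc. - e < c} = (if - e < c then bidisc else {})" for c by auto
  ultimately show ?thesis using assms unfolding neg_psh_def usc_on_def by auto
qed

lemma pole_fun_le_green:
  assumes I: "finite I" and a: "\<forall>i\<in>I. a i \<in> unit_disc" and mu: "\<forall>i\<in>I. mu i \<ge> 1"
    and z: "z \<in> bidisc"
  shows "pole_fun I a mu z \<le> green I (\<lambda>i. (a i, 0)) mu z"
proof (cases "I = {}")
  case False
  then show ?thesis unfolding green_def
    using neg_psh_pole_fun[OF I False a mu] has_poles_pole_fun[OF I a] by (intro Sup_upper) blast
next
  case True
  have *: "ereal (- e) \<le> green I (\<lambda>i. (a i, 0)) mu z" if "e > 0" for e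
    unfolding green_def using neg_psh_const[OF that] True
    by (intro Sup_upper CollectI exI[of _ "\<lambda>_. ereal (- e)"]) (auto simp: has_poles_def)
  have "0 \<le> green I (\<lambda>i. (a i, 0)) mu z"
  proof (rule ccontr)
    assume "\<not> ?thesis"
    then obtain r where r: "green I (\<lambda>i. (a i, 0)) mu z < ereal r" "ereal r < 0"
      using ereal_dense2[of "green I (\<lambda>i. (a i, 0)) mu z" 0] by (auto simp: not_le)
    with *[of "- r"] show False by simp
  qed
  then show ?thesis using True z elog_neg[of "snd z"]
    by (auto simp: pole_fun_def fin_blaschke_def bidisc_def)
qed

section \<open>A maximum principle along analytic discs\<close>

text \<open>The boundary values of \<open>u\<close> are replaced by a harmonic majorant, whose mean
  is its central value. In \<open>ennreal\<close> this is informative only for negative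
  \<open>Re (h 0)\<close>; otherwise the claim follows from \<open>u x < 0\<close>.\<close>

lemma neg_psh_le_Re_holomorphic:
  assumes u: "neg_psh u" and disc: "\<And>l. cmod l \<le> 1 \<Longrightarrow> cline x b l \<in> bidisc"
    and h: "h holomorphic_on cball 0 1"
    and le: "\<And>t. u (cline x b (cis t)) \<le> ereal (Re (h (cis t)))"
  shows "u x \<le> ereal (Re (h 0))"
proof -
  have "cline x b 0 = x" by (simp add: cline_def)
  then have x: "x \<in> bidisc" using disc[of 0] by simp
  have neg: "u x < 0" using u x by (simp add: neg_psh_def)
  let ?J = "\<integral>\<^sup>+ t. indicator {0..2*pi} t * e2ennreal (- u (cline x b (cis t))) \<partial>lborel"
  have cont: "continuous_on {0..2*pi} (\<lambda>t. - Re (h (cis t)))"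
    by (intro continuous_intros continuous_on_compose2[OF holomorphic_on_imp_continuous_on[OF h]]) auto
  have "ennreal (- (2 * pi * Re (h 0))) \<le> (\<integral>\<^sup>+ t. indicator {0..2*pi} t * ennreal (- Re (h (cis t))) \<partial>lborel)"
    by (intro has_integral_le_nn_integral has_integral_neg Re_holomorphic_circle_mean h cont)
  also have "\<dots> \<le> ?J"
  proof (intro nn_integral_mono mult_left_mono)
    fix t
    have "ereal (- Re (h (cis t))) \<le> - u (cline x b (cis t))"
      using le[of t] by (metis ereal_minus_le_minus uminus_ereal.simps(1))
    from e2ennreal_mono[OF this] show "ennreal (- Re (h (cis t))) \<le> e2ennreal (- u (cline x b (cis t)))"
      by (simp add: e2ennreal_ereal)
  qed auto
  finally have "ennreal (1 / (2 * pi)) * ennreal (- (2 * pi * Re (h 0))) \<le> ennreal (1 / (2 * pi)) * ?J"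
    by (intro mult_left_mono) auto
  also have "\<dots> \<le> e2ennreal (- u x)"
    using u disc unfolding neg_psh_def by blast
  finally have "ennreal (1 / (2 * pi)) * ennreal (- (2 * pi * Re (h 0))) \<le> e2ennreal (- u x)" .
  then have *: "ennreal (- Re (h 0)) \<le> e2ennreal (- u x)"
    by (simp add: ennreal_mult'[symmetric])
  show ?thesis
  proof (cases "Re (h 0) \<ge> 0")
    case True
    then show ?thesis using neg by (metis ereal_less_eq(5) less_imp_le order_trans)
  next
    case False
    from * have "enn2ereal (ennreal (- Re (h 0))) \<le> enn2ereal (e2ennreal (- u x))"
      by (simp only: less_eq_ennreal.rep_eq)
    then have "ereal (- Re (h 0)) \<le> - u x"
      using False neg by (simp add: enn2ereal_e2ennreal enn2ereal_ennreal)
    then show ?thesis by (metis ereal_minus_le_minus uminus_ereal.simps(1))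
  qed
qed

text \<open>Without a maximum, the sublevel sets at real levels exceeded somewhere by
  \<open>F\<close> would cover \<open>T\<close>. The largest level of a finite subcover is exceeded
  at some \<open>y\<close>, which then lies in no member of it.\<close>

lemma usc_attains_max:
  fixes F :: "'a::topological_space \<Rightarrow> ereal"
  assumes T: "compact T" "T \<noteq> {}"
    and usc: "\<And>c::real. openin (top_of_set T) {x \<in> T. F x < ereal c}"
  shows "\<exists>x\<in>T. \<forall>y\<in>T. F y \<le> F x"
proof (rule ccontr)
  assume "\<not> ?thesis"
  then have no: "\<exists>y\<in>T. F x < F y" if "x \<in> T" for x
    using that not_le by blast
  define R where "R = {r::real. \<exists>y\<in>T. ereal r < F y}"
  have "T \<subseteq> \<Union> ((\<lambda>r. {x \<in> T. F x < ereal r}) ` R)"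
  proof
    fix x assume x: "x \<in> T"
    then obtain y where y: "y \<in> T" "F x < F y" using no by blast
    then obtain r where "F x < ereal r" "ereal r < F y" using ereal_dense2 by blast
    then show "x \<in> \<Union> ((\<lambda>r. {x \<in> T. F x < ereal r}) ` R)" using x y by (auto simp: R_def)
  qed
  then obtain D where D: "D \<subseteq> (\<lambda>r. {x \<in> T. F x < ereal r}) ` R" "finite D" "T \<subseteq> \<Union>D"
    using T(1)[unfolded compact_eq_openin_cover] usc by (metis (no_types, lifting) imageE)
  then obtain R' where R': "R' \<subseteq> R" "finite R'" "D = (\<lambda>r. {x \<in> T. F x < ereal r}) ` R'"
    by (meson finite_subset_image)
  have "R' \<noteq> {}" using D R' T by auto
  then have "Max R' \<in> R" using R' by (meson Max_in subsetD)
  then obtain y where y: "y \<in> T" "ereal (Max R') < F y" by (auto simp: R_def)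
  then obtain r where "r \<in> R'" "F y < ereal r" using D R' by blast
  then show False using y R'(2) by (meson Max_ge ereal_less_eq(3) leD less_trans order_less_le_trans)
qed

text \<open>The sum is below \<open>c\<close> iff some real \<open>d\<close> has
  \<open>u < d\<close> and \<open>\<psi> < c - d\<close>. This writes the set as a union of open
  pieces and copes with the value -\<infinity> of \<open>u\<close>.\<close>

lemma openin_usc_plus_continuous:
  fixes \<psi> :: "'a::topological_space \<times> c2 \<Rightarrow> real"
  assumes u: "usc_on bidisc u" and \<psi>: "continuous_on X \<psi>" and X: "snd ` X \<subseteq> bidisc"
  shows "openin (top_of_set X) {x \<in> X. u (snd x) + ereal (\<psi> x) < ereal c}"
proof -
  have eq: "{x \<in> X. u (snd x) + ereal (\<psi> x) < ereal c}
    = (\<Union>d::real. (X \<inter> snd -` {w \<in> bidisc. u w < ereal d}) \<inter> (X \<inter> \<psi> -` {..<c - d}))"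
  proof (intro equalityI subsetI)
    fix x assume x: "x \<in> {x \<in> X. u (snd x) + ereal (\<psi> x) < ereal c}"
    then have "u (snd x) < ereal (c - \<psi> x)" by (cases "u (snd x)") auto
    then obtain d where "u (snd x) < ereal d" "ereal d < ereal (c - \<psi> x)" using ereal_dense2 by blast
    then show "x \<in> (\<Union>d::real. (X \<inter> snd -` {w \<in> bidisc. u w < ereal d}) \<inter> (X \<inter> \<psi> -` {..<c - d}))"
      using x X by (intro UN_I[of d]) auto
  next
    fix x assume "x \<in> (\<Union>d::real. (X \<inter> snd -` {w \<in> bidisc. u w < ereal d}) \<inter> (X \<inter> \<psi> -` {..<c - d}))"
    then obtain d where "x \<in> X" "u (snd x) < ereal d" "\<psi> x < c - d" by auto
    then show "x \<in> {x \<in> X. u (snd x) + ereal (\<psi> x) < ereal c}" by (cases "u (snd x)") auto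
  qed
  have "openin (top_of_set X) (X \<inter> snd -` {w \<in> bidisc. u w < ereal d})" for d
    using u X unfolding usc_on_def
    by (intro continuous_openin_preimage[where T = bidisc]) (auto intro!: continuous_intros)
  moreover have "openin (top_of_set X) (X \<inter> \<psi> -` {..<c - d})" for d
    by (intro continuous_openin_preimage_gen \<psi>) auto
  ultimately show ?thesis unfolding eq by (intro openin_Union) auto
qed

lemma holo_disc_continuous_on: "holo_disc \<phi> \<Longrightarrow> continuous_on unit_disc \<phi>"
proof -
  assume "holo_disc \<phi>"
  then have "continuous_on unit_disc (\<lambda>t. ((fst \<circ> \<phi>) t, (snd \<circ> \<phi>) t))"
    unfolding holo_disc_def by (intro continuous_on_Pair holomorphic_on_imp_continuous_on; simp add: comp_def)
  then show ?thesis by simp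
qed

lemma open_bidisc: "open bidisc"
proof -
  have "bidisc = ball 0 1 \<times> ball 0 1" by (auto simp: bidisc_def)
  then show ?thesis by (metis open_Times open_ball)
qed

text \<open>With \<open>x\<close> holomorphic and \<open>y\<close> its value at the centre, the part up to the last square is the
  real part of a holomorphic function.\<close>
lemma cmod_power2_expand: "(cmod x)\<^sup>2 = 2 * Re (cnj y * x) - (cmod y)\<^sup>2 + (cmod (x - y))\<^sup>2"
  by (simp add: cmod_power2) (simp add: power2_eq_square algebra_simps)

lemma linear_approx:
  assumes "g holomorphic_on S" "open S" "t \<in> S" "e > 0"
  obtains d r where "r > 0" "\<And>l. cmod l < r \<Longrightarrow> cmod (g (t + l) - g t - l * d) \<le> e * cmod l"
proof -
  obtain d where "(g has_field_derivative d) (at t)"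
    using assms holomorphic_on_open by blast
  then have "(g has_derivative (*) d) (at t)" by (simp add: has_field_derivative_def)
  then obtain r where r: "r > 0" "\<And>y. cmod (y - t) < r \<Longrightarrow> cmod (g y - g t - d * (y - t)) \<le> e * cmod (y - t)"
    using \<open>e > 0\<close> unfolding has_derivative_at_alt by blast
  show thesis
    by (rule that[OF r(1), of d]) (use r(2)[of "t + _"] in \<open>simp add: mult.commute\<close>)
qed

text \<open>The pairs (t, w) with \<open>u w < H t\<close> form a relatively open set containing the
  compact graph of \<open>\<phi>\<close> over \<open>C\<close>, hence also a tube of uniform radius
  around it.\<close>

lemma tube_below:
  fixes C :: "'a::metric_space set"
  assumes u: "neg_psh u" and phi: "continuous_on C \<phi>" "\<phi> ` C \<subseteq> bidisc"
    and C: "compact C" and H: "continuous_on C H"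
    and below: "\<And>t. t \<in> C \<Longrightarrow> u (\<phi> t) < ereal (H t)"
  obtains \<delta> where "\<delta> > 0" "\<And>t w. t \<in> C \<Longrightarrow> w \<in> bidisc \<Longrightarrow> dist (\<phi> t) w \<le> \<delta> \<Longrightarrow> u w < ereal (H t)"
proof -
  let ?X = "C \<times> bidisc"
  have "continuous_on ?X (\<lambda>x. - H (fst x))"
    by (intro continuous_intros continuous_on_compose2[OF H]) auto
  then have "openin (top_of_set ?X) {x \<in> ?X. u (snd x) + ereal (- H (fst x)) < ereal 0}"
    using u by (intro openin_usc_plus_continuous) (auto simp: neg_psh_def)
  then obtain O' where O': "open O'" "{x \<in> ?X. u (snd x) + ereal (- H (fst x)) < ereal 0} = ?X \<inter> O'"
    by (auto simp: openin_open)
  have iff: "u w + ereal (- h) < ereal 0 \<longleftrightarrow> u w < ereal h" for w h by (cases "u w") auto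
  have "compact ((\<lambda>t. (t, \<phi> t)) ` C)"
    by (intro compact_continuous_image C continuous_intros phi)
  moreover have "(\<lambda>t. (t, \<phi> t)) ` C \<subseteq> O'"
  proof
    fix x assume "x \<in> (\<lambda>t. (t, \<phi> t)) ` C"
    then have "x \<in> {x \<in> ?X. u (snd x) + ereal (- H (fst x)) < ereal 0}"
      using phi(2) below unfolding iff by auto
    then show "x \<in> O'" using O' by blast
  qed
  ultimately obtain \<delta> where \<delta>: "\<delta> > 0" "(\<Union>x\<in>(\<lambda>t. (t, \<phi> t)) ` C. cball x \<delta>) \<subseteq> O'"
    using compact_subset_open_imp_cball_epsilon_subset O'(1) by metis
  show thesis
  proof (rule that[OF \<delta>(1)])
    fix t w assume t: "t \<in> C" "w \<in> bidisc" "dist (\<phi> t) w \<le> \<delta>"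
    then have "(t, w) \<in> cball (t, \<phi> t) \<delta>" by (simp add: dist_Pair_Pair)
    with t \<delta>(2) have "(t, w) \<in> ?X \<inter> O'" by blast
    then show "u w < ereal (H t)" unfolding O'(2)[symmetric] iff by (simp add: iff)
  qed
qed

text \<open>Where \<open>f\<close> has no zeros, log|f| is locally the real part of a holomorphic
  function, so the majorant is harmonic. The tube supplies the room in which straight discs can
  replace the curved disc \<open>\<phi>\<close>.\<close>

lemma disc_maximum_principle:
  fixes c e :: real
  assumes u: "neg_psh u" and phi: "holo_disc \<phi>" and K: "compact K" "K \<subseteq> unit_disc"
    and f: "f holomorphic_on unit_disc" "\<And>t. t \<in> K \<Longrightarrow> f t \<noteq> 0"
    and bd: "\<And>t. t \<in> K - interior K \<Longrightarrow> u (\<phi> t) < ereal (c * ln (cmod (f t)) + e)"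
    and t0: "t0 \<in> K"
  shows "u (\<phi> t0) \<le> ereal (c * ln (cmod (f t0)) + e)"
proof (rule ccontr)
  define H where "H t = c * ln (cmod (f t)) + e" for t
  assume "\<not> ?thesis"
  then obtain m where m: "H t0 < m" "ereal m < u (\<phi> t0)"
    using ereal_dense2[of "ereal (H t0)" "u (\<phi> t0)"] by (auto simp: H_def not_le)
  \<comment> \<open>Half the gap: \<open>F\<close> below will exceed \<open>2 * \<eta>\<close> at
    \<open>(t0, \<phi> t0)\<close>, while its quadratic term in \<open>t\<close> contributes at most
    \<eta>.\<close>
  define \<eta> where "\<eta> = (m - H t0) / 2"
  have \<eta>: "\<eta> > 0" using m by (simp add: \<eta>_def)
  have u0: "u x < 0" if "x \<in> bidisc" for x using u that by (simp add: neg_psh_def)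
  have phiD: "\<phi> ` K \<subseteq> bidisc" using phi K unfolding holo_disc_def by blast
  have cphi: "continuous_on K \<phi>"
    using holo_disc_continuous_on[OF phi] K(2) by (rule continuous_on_subset)
  have cH: "continuous_on K H"
    unfolding H_def using f K
    by (intro continuous_intros continuous_on_subset[OF holomorphic_on_imp_continuous_on[OF f(1)]]) auto
  obtain \<delta>1 where \<delta>1: "\<delta>1 > 0" "(\<Union>x\<in>\<phi> ` K. cball x \<delta>1) \<subseteq> bidisc"
    using compact_subset_open_imp_cball_epsilon_subset[OF compact_continuous_image[OF cphi K(1)] open_bidisc phiD]
    by blast
  have "compact (K - interior K)" by (intro compact_diff K open_interior)
  obtain \<delta>2 where \<delta>2: "\<delta>2 > 0"
    "\<And>t w. t \<in> K - interior K \<Longrightarrow> w \<in> bidisc \<Longrightarrow> dist (\<phi> t) w \<le> \<delta>2 \<Longrightarrow> u w < ereal (H t)"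
  proof (rule tube_below[OF u])
    show "continuous_on (K - interior K) \<phi>" "continuous_on (K - interior K) H"
      using cphi cH continuous_on_subset by blast+
    show "\<phi> ` (K - interior K) \<subseteq> bidisc" using phiD by blast
    show "compact (K - interior K)" by fact
    show "u (\<phi> t) < ereal (H t)" if "t \<in> K - interior K" for t
      using bd[OF that] by (simp add: H_def)
  qed blast
  define \<delta> where "\<delta> = min \<delta>1 \<delta>2"
  have \<delta>: "\<delta> > 0" "\<delta> \<le> \<delta>1" "\<delta> \<le> \<delta>2" using \<delta>1 \<delta>2 by (auto simp: \<delta>_def)
  have "bounded (H ` K)" using compact_continuous_image[OF cH K(1)] compact_imp_bounded by blast
  then obtain A where A: "\<And>t. t \<in> K \<Longrightarrow> \<bar>H t\<bar> \<le> A" unfolding bounded_iff by auto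
  \<comment> \<open>At distance \<delta> from the graph the penalty equals
    \<open>\<bar>A\<bar> + \<eta>\<close>; since \<open>u\<close> is negative and -H is at most
    \<open>A\<close>, \<open>F\<close> is negative there.\<close>
  define L where "L = (\<bar>A\<bar> + \<eta>) / \<delta>\<^sup>2"
  have L: "L > 0" "L * \<delta>\<^sup>2 = \<bar>A\<bar> + \<eta>" using \<delta> \<eta> by (auto simp: L_def)
  define \<psi> where "\<psi> x = - H (fst x) - L * ((cmod (fst (snd x) - fst (\<phi> (fst x))))\<^sup>2
      + (cmod (snd (snd x) - snd (\<phi> (fst x))))\<^sup>2) + \<eta> * (cmod (fst x))\<^sup>2" for x :: "complex \<times> c2"
  define T where "T = (\<lambda>x. (fst x, \<phi> (fst x) + snd x)) ` (K \<times> cball 0 \<delta>)"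
  have Tiff: "(t, w) \<in> T \<longleftrightarrow> t \<in> K \<and> norm (w - \<phi> t) \<le> \<delta>" for t w
    unfolding T_def by (force intro!: image_eqI[of _ _ "(t, w - \<phi> t)"])
  have cphi1: "continuous_on (K \<times> X) (\<lambda>x. \<phi> (fst x))" for X :: "c2 set"
    by (intro continuous_on_compose2[OF cphi] continuous_intros) auto
  have cT: "compact T" unfolding T_def
    by (intro compact_continuous_image compact_Times K compact_cball continuous_intros cphi1)
  have TK: "T \<subseteq> K \<times> UNIV" using Tiff by auto
  have c\<psi>: "continuous_on T \<psi>"
  proof -
    have "continuous_on (K \<times> UNIV) \<psi>" unfolding \<psi>_def
      by (intro continuous_intros cphi1 continuous_on_compose2[OF cH]) auto
    then show ?thesis using TK by (rule continuous_on_subset)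
  qed
  have TD: "snd ` T \<subseteq> bidisc"
  proof
    fix w assume "w \<in> snd ` T"
    then obtain t where "t \<in> K" "norm (w - \<phi> t) \<le> \<delta>" using Tiff by auto
    then have "w \<in> cball (\<phi> t) \<delta>1" using \<delta> by (simp add: dist_norm norm_minus_commute)
    then show "w \<in> bidisc" using \<open>t \<in> K\<close> \<delta>1(2) by blast
  qed
  have T0: "(t0, \<phi> t0) \<in> T" using t0 \<delta> by (simp add: Tiff)
  define F where "F x = u (snd x) + ereal (\<psi> x)" for x
  have "\<exists>x\<in>T. \<forall>y\<in>T. F y \<le> F x"
  proof (rule usc_attains_max[OF cT])
    show "T \<noteq> {}" using T0 by auto
    show "openin (top_of_set T) {x \<in> T. F x < ereal c}" for c
      unfolding F_def using u c\<psi> TD by (intro openin_usc_plus_continuous) (auto simp: neg_psh_def)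
  qed
  then obtain t1 w1 where tw: "(t1, w1) \<in> T" and max: "\<And>y. y \<in> T \<Longrightarrow> F y \<le> F (t1, w1)" by auto
  have t1: "t1 \<in> K" "norm (w1 - \<phi> t1) \<le> \<delta>" using tw Tiff by auto
  have w1D: "w1 \<in> bidisc" using TD tw by force
  have "ereal (2 * \<eta>) < F (t0, \<phi> t0)"
  proof -
    have "2 * \<eta> \<le> m + \<psi> (t0, \<phi> t0)" using \<eta> by (simp add: \<psi>_def \<eta>_def)
    then show ?thesis using m unfolding F_def by (cases "u (\<phi> t0)") auto
  qed
  also have "\<dots> \<le> F (t1, w1)" using max T0 by blast
  finally have big: "ereal (2 * \<eta>) < F (t1, w1)" .
  obtain U where U: "u w1 = ereal U" "U < 0"
    using big u0[OF w1D] unfolding F_def by (cases "u w1") auto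
  have bigU: "2 * \<eta> < U + \<psi> (t1, w1)" using big U by (simp add: F_def)
  have t1sq: "\<eta> * (cmod t1)\<^sup>2 \<le> \<eta>"
    using t1 K \<eta> by (auto simp: unit_disc_def power_le_one intro!: mult_left_le)
  have nrm: "(cmod (fst v))\<^sup>2 + (cmod (snd v))\<^sup>2 = (norm v)\<^sup>2" for v :: c2
    by (simp add: norm_prod_def)
  have \<psi>1: "\<psi> (t1, w1) = - H t1 - L * (norm (w1 - \<phi> t1))\<^sup>2 + \<eta> * (cmod t1)\<^sup>2"
    unfolding \<psi>_def nrm[symmetric] by simp
  \<comment> \<open>Otherwise the tube bound gives \<open>u w1 < H t1\<close>, and
    \<open>F (t1, w1)\<close> would be less than \<eta>.\<close>
  have int: "t1 \<in> interior K"
  proof (rule ccontr)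
    assume "t1 \<notin> interior K"
    then have "u w1 < ereal (H t1)"
      using \<delta>2(2)[of t1 w1] t1 w1D \<delta> by (auto simp: dist_norm norm_minus_commute)
    moreover have "0 \<le> L * (norm (w1 - \<phi> t1))\<^sup>2" using L by simp
    ultimately show False using bigU U \<psi>1 t1sq \<eta> by simp
  qed
  have strict: "norm (w1 - \<phi> t1) < \<delta>"
  proof (rule ccontr)
    assume "\<not> ?thesis"
    then have "L * (norm (w1 - \<phi> t1))\<^sup>2 = \<bar>A\<bar> + \<eta>" using t1 L by simp
    then show False using bigU U \<psi>1 t1sq \<eta> A[OF t1(1)] by linarith
  qed
  \<comment> \<open>Each component has linearisation error at most \<open>q * r\<close> on a circle
    of radius \<open>r\<close>. Beyond their harmonic part the two penalties then cost at most
    \<open>2 * L * (q * r)^2 = \<eta> * r^2 / 2\<close>, half of the gain.\<close>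
  define q where "q = sqrt (\<eta> / (4 * L))"
  have q: "q > 0" "2 * L * q\<^sup>2 = \<eta> / 2" using \<eta> L by (auto simp: q_def)
  have t1D: "t1 \<in> unit_disc" using t1 K by blast
  have oD: "open unit_disc" by (simp add: unit_disc_def)
  have holo: "(fst \<circ> \<phi>) holomorphic_on unit_disc" "(snd \<circ> \<phi>) holomorphic_on unit_disc"
    using phi by (auto simp: holo_disc_def)
  obtain d1 r1 where d1: "r1 > 0" "\<And>l. cmod l < r1 \<Longrightarrow> cmod (fst (\<phi> (t1 + l)) - fst (\<phi> t1) - l * d1) \<le> q * cmod l"
    using linear_approx[OF holo(1) oD t1D q(1), unfolded o_def] by blast
  obtain d2 r2 where d2: "r2 > 0" "\<And>l. cmod l < r2 \<Longrightarrow> cmod (snd (\<phi> (t1 + l)) - snd (\<phi> t1) - l * d2) \<le> q * cmod l"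
    using linear_approx[OF holo(2) oD t1D q(1), unfolded o_def] by blast
  obtain r3 where r3: "r3 > 0" "ball t1 r3 \<subseteq> K" using int by (auto simp: mem_interior)
  \<comment> \<open>Below this radius the displacement, of norm at most \<open>2 * q * r\<close>,
    keeps the disc through \<open>w1\<close> inside the tube.\<close>
  define r4 where "r4 = (\<delta> - norm (w1 - \<phi> t1)) / (2 * q)"
  have r4: "r4 > 0" using strict q by (simp add: r4_def)
  define r where "r = min (min r1 r2) (min r3 r4) / 2"
  have r: "r > 0" "r < r1" "r < r2" "r < r3" "r < r4" using d1 d2 r3 r4 by (auto simp: r_def)
  have "f holomorphic_on ball t1 r3" using f(1) r3(2) K(2) by (meson holomorphic_on_subset subset_trans)
  \<comment> \<open>On a ball \<open>f\<close> has a holomorphic logarithm \<open>g\<close>, which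
    makes \<open>H\<close> the real part of \<open>c * g + e\<close>.\<close>
  then obtain g where g: "g holomorphic_on ball t1 r3" "\<And>z. z \<in> ball t1 r3 \<Longrightarrow> f z = exp (g z)"
    using contractible_imp_holomorphic_log[of f "ball t1 r3"] f(2) r3(2)
    by (metis convex_ball convex_imp_contractible subsetD)
  have Re_g: "H z = c * Re (g z) + e" if "z \<in> ball t1 r3" for z
    unfolding H_def g(2)[OF that] by simp
  define P where "P l = t1 + of_real r * l" for l
  define D1 where "D1 l = fst w1 + of_real r * l * d1 - fst (\<phi> (P l))" for l
  define D2 where "D2 l = snd w1 + of_real r * l * d2 - snd (\<phi> (P l))" for l
  define b where "b = (of_real r * d1, of_real r * d2)"
  \<comment> \<open>Holomorphic, with real part equal to \<psi> at the centre of the disc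
    \<open>l \<mapsto> (P l, cline w1 b l)\<close> and below it by at least \<kappa> on its circle;
    the squares enter through \<open>cmod_power2_expand\<close>.\<close>
  define E where "E l = - (of_real c * g (P l) + of_real e)
     - of_real L * (2 * (cnj (D1 0) * D1 l) - of_real ((cmod (D1 0))\<^sup>2)
                  + (2 * (cnj (D2 0) * D2 l) - of_real ((cmod (D2 0))\<^sup>2)))
     + of_real \<eta> * (of_real ((cmod t1)\<^sup>2) + 2 * (cnj t1 * (of_real r * l)))" for l
  define M where "M = U + \<psi> (t1, w1)"
  define \<kappa> where "\<kappa> = \<eta> * r\<^sup>2 / 2"
  have small: "cmod (of_real r * l) \<le> r" if "cmod l \<le> 1" for l
    using r that by (simp add: norm_mult mult_left_le)
  have P3: "P l \<in> ball t1 r3" if "cmod l \<le> 1" for l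
  proof -
    have "dist t1 (P l) = cmod (of_real r * l)" by (simp add: P_def dist_norm norm_mult)
    then show ?thesis using small[OF that] r(4) unfolding mem_ball by linarith
  qed
  have PK: "P l \<in> K" if "cmod l \<le> 1" for l using P3[OF that] r3 by blast
  have DD: "cmod (D1 l - D1 0) \<le> q * r" "cmod (D2 l - D2 0) \<le> q * r" if "cmod l \<le> 1" for l
  proof -
    note s = small[OF that]
    have "cmod (D1 l - D1 0) = cmod (fst (\<phi> (t1 + of_real r * l)) - fst (\<phi> t1) - of_real r * l * d1)"
      by (subst norm_minus_cancel[symmetric]) (simp add: D1_def P_def algebra_simps)
    also have "\<dots> \<le> q * cmod (of_real r * l)" using s r(2) by (intro d1(2)) linarith
    also have "\<dots> \<le> q * r" using s q by simp
    finally show "cmod (D1 l - D1 0) \<le> q * r" .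
    have "cmod (D2 l - D2 0) = cmod (snd (\<phi> (t1 + of_real r * l)) - snd (\<phi> t1) - of_real r * l * d2)"
      by (subst norm_minus_cancel[symmetric]) (simp add: D2_def P_def algebra_simps)
    also have "\<dots> \<le> q * cmod (of_real r * l)" using s r(3) by (intro d2(2)) linarith
    also have "\<dots> \<le> q * r" using s q by simp
    finally show "cmod (D2 l - D2 0) \<le> q * r" .
  qed
  have lineT: "(P l, cline w1 b l) \<in> T" if "cmod l \<le> 1" for l
  proof -
    have "cline w1 b l - \<phi> (P l) = (D1 l, D2 l)"
      by (simp add: cline_def b_def D1_def D2_def prod_eq_iff mult_ac)
    moreover have "(D1 0, D2 0) = w1 - \<phi> t1" by (simp add: D1_def D2_def P_def prod_eq_iff)
    ultimately have "cline w1 b l - \<phi> (P l) = (w1 - \<phi> t1) + (D1 l - D1 0, D2 l - D2 0)"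
      by (simp add: prod_eq_iff)
    then have "norm (cline w1 b l - \<phi> (P l)) \<le> norm (w1 - \<phi> t1) + norm (D1 l - D1 0, D2 l - D2 0)"
      using norm_triangle_ineq by metis
    also have "norm (D1 l - D1 0, D2 l - D2 0) \<le> 2 * q * r"
      using norm_Pair_le[of "D1 l - D1 0" "D2 l - D2 0"] DD[OF that] by linarith
    also have "2 * q * r \<le> \<delta> - norm (w1 - \<phi> t1)"
      using r(5) q by (simp add: r4_def field_simps)
    finally show ?thesis using PK[OF that] by (simp add: Tiff)
  qed
  have \<psi>_ge: "\<psi> (P l, cline w1 b l) \<ge> Re (E l) + \<kappa>" if "cmod l = 1" for l
  proof -
    have l: "cmod l \<le> 1" using that by simp
    have 1: "(cmod (D1 l))\<^sup>2 \<le> 2 * Re (cnj (D1 0) * D1 l) - (cmod (D1 0))\<^sup>2 + (q * r)\<^sup>2"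
      unfolding cmod_power2_expand[of "D1 l" "D1 0"] using DD[OF l] by (simp add: power_mono)
    have 2: "(cmod (D2 l))\<^sup>2 \<le> 2 * Re (cnj (D2 0) * D2 l) - (cmod (D2 0))\<^sup>2 + (q * r)\<^sup>2"
      unfolding cmod_power2_expand[of "D2 l" "D2 0"] using DD[OF l] by (simp add: power_mono)
    have 3: "(cmod (P l))\<^sup>2 = (cmod t1)\<^sup>2 + 2 * Re (cnj t1 * (of_real r * l)) + r\<^sup>2"
    proof -
      have "Re (cnj t1 * t1) = (cmod t1)\<^sup>2" unfolding cmod_power2 by (simp add: power2_eq_square)
      moreover have "cmod (P l - t1) = r" using that r by (simp add: P_def norm_mult)
      moreover have "cnj t1 * P l = cnj t1 * t1 + cnj t1 * (of_real r * l)" by (simp add: P_def distrib_left)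
      moreover define X where "X = Re (cnj t1 * (of_real r * l))"
      ultimately have "Re (cnj t1 * P l) = (cmod t1)\<^sup>2 + X" and "cmod (P l - t1) = r"
        by (simp_all only: plus_complex.sel)
      with cmod_power2_expand[of "P l" t1] show ?thesis by (fold X_def) algebra
    qed
    have 4: "L * ((cmod (D1 l))\<^sup>2 + (cmod (D2 l))\<^sup>2) \<le>
       L * (2 * Re (cnj (D1 0) * D1 l) - (cmod (D1 0))\<^sup>2 + (2 * Re (cnj (D2 0) * D2 l) - (cmod (D2 0))\<^sup>2)) + \<eta> / 2 * r\<^sup>2"
    proof -
      have "L * ((cmod (D1 l))\<^sup>2 + (cmod (D2 l))\<^sup>2) \<le>
        L * (2 * Re (cnj (D1 0) * D1 l) - (cmod (D1 0))\<^sup>2 + (2 * Re (cnj (D2 0) * D2 l) - (cmod (D2 0))\<^sup>2) + 2 * (q * r)\<^sup>2)"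
        using 1 2 L by (intro mult_left_mono) auto
      also have "\<dots> = L * (2 * Re (cnj (D1 0) * D1 l) - (cmod (D1 0))\<^sup>2 + (2 * Re (cnj (D2 0) * D2 l) - (cmod (D2 0))\<^sup>2)) + (2 * L * q\<^sup>2) * r\<^sup>2"
        by (simp add: power_mult_distrib distrib_left)
      finally show ?thesis unfolding q(2) .
    qed
    have ReE: "Re (E l) = - (c * Re (g (P l)) + e)
      - L * (2 * Re (cnj (D1 0) * D1 l) - (cmod (D1 0))\<^sup>2 + (2 * Re (cnj (D2 0) * D2 l) - (cmod (D2 0))\<^sup>2))
      + \<eta> * ((cmod t1)\<^sup>2 + 2 * Re (cnj t1 * (of_real r * l)))"
      by (simp add: E_def)
    have "\<psi> (P l, cline w1 b l) = - H (P l) - L * ((cmod (D1 l))\<^sup>2 + (cmod (D2 l))\<^sup>2) + \<eta> * (cmod (P l))\<^sup>2"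
      by (simp add: \<psi>_def cline_def b_def D1_def D2_def mult_ac)
    also have "H (P l) = c * Re (g (P l)) + e" using Re_g P3[OF l] by blast
    finally show ?thesis using 4 unfolding ReE 3 \<kappa>_def by (simp add: distrib_left)
  qed
  have E0: "Re (E 0) = \<psi> (t1, w1)"
  proof -
    have "D1 0 = fst (w1 - \<phi> t1)" "D2 0 = snd (w1 - \<phi> t1)" by (auto simp: D1_def D2_def P_def)
    then have n: "(norm (w1 - \<phi> t1))\<^sup>2 = (cmod (D1 0))\<^sup>2 + (cmod (D2 0))\<^sup>2" using nrm[of "w1 - \<phi> t1"] by simp
    have z: "Re (cnj z * z) = (cmod z)\<^sup>2" for z unfolding cmod_power2 by (simp add: power2_eq_square)
    have "Re (E 0) = - (c * Re (g t1) + e) - L * (2 * Re (cnj (D1 0) * D1 0) - (cmod (D1 0))\<^sup>2 + (2 * Re (cnj (D2 0) * D2 0) - (cmod (D2 0))\<^sup>2))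
      + \<eta> * (cmod t1)\<^sup>2"
      by (simp add: E_def P_def)
    also have "c * Re (g t1) + e = H t1" using Re_g[of t1] r3 by simp
    finally show ?thesis unfolding z \<psi>1 n by simp
  qed
  \<comment> \<open>Maximality of \<open>F\<close> at \<open>(t1, w1)\<close> makes
    \<open>Re (h l)\<close> a majorant of \<open>u\<close> on the circle, whereas
    \<open>Re (h 0)\<close> equals \<open>U - \<kappa>\<close>, less than the value of
    \<open>u\<close> at the centre.\<close>
  define h where "h l = of_real (M - \<kappa>) - E l" for l
  have Pholo: "P holomorphic_on cball 0 1" unfolding P_def by (intro holomorphic_intros)
  have PD: "P ` cball 0 1 \<subseteq> unit_disc" "P ` cball 0 1 \<subseteq> ball t1 r3" using PK K P3 by auto
  have h: "h holomorphic_on cball 0 1"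
  proof -
    have gP: "(\<lambda>l. g (P l)) holomorphic_on cball 0 1"
      using holomorphic_on_compose_gen[OF Pholo g(1) PD(2)] by (simp add: o_def)
    have fP: "(\<lambda>l. fst (\<phi> (P l))) holomorphic_on cball 0 1"
      using holomorphic_on_compose_gen[OF Pholo holo(1) PD(1)] by (simp add: o_def)
    have sP: "(\<lambda>l. snd (\<phi> (P l))) holomorphic_on cball 0 1"
      using holomorphic_on_compose_gen[OF Pholo holo(2) PD(1)] by (simp add: o_def)
    have "D1 holomorphic_on cball 0 1" "D2 holomorphic_on cball 0 1"
      unfolding D1_def D2_def by (intro holomorphic_intros fP sP)+
    then show ?thesis unfolding h_def E_def by (intro holomorphic_intros gP)
  qed
  have "u w1 \<le> ereal (Re (h 0))"
  proof (rule neg_psh_le_Re_holomorphic[OF u _ h])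
    show "cline w1 b l \<in> bidisc" if "cmod l \<le> 1" for l
      using lineT[OF that] TD by force
    show "u (cline w1 b (cis t)) \<le> ereal (Re (h (cis t)))" for t
    proof -
      have "F (P (cis t), cline w1 b (cis t)) \<le> F (t1, w1)" using lineT[of "cis t"] by (intro max) simp
      then have "u (cline w1 b (cis t)) + ereal (\<psi> (P (cis t), cline w1 b (cis t))) \<le> ereal M"
        by (simp add: F_def U M_def)
      moreover have "\<psi> (P (cis t), cline w1 b (cis t)) \<ge> Re (E (cis t)) + \<kappa>" by (intro \<psi>_ge) simp
      ultimately show ?thesis by (cases "u (cline w1 b (cis t))") (auto simp: h_def)
    qed
  qed
  then have "U \<le> M - \<kappa> - \<psi> (t1, w1)" by (simp add: U h_def E0)
  moreover have "\<kappa> > 0" using \<eta> r(1) by (simp add: \<kappa>_def)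
  ultimately show False by (simp add: M_def)
qed

section \<open>The Green function is at most the Lempert function\<close>

lemma continuous_on_fin_blaschke:
  assumes "\<forall>i\<in>I. a i \<in> unit_disc"
  shows "continuous_on (cball 0 1) (fin_blaschke I a mu)"
  unfolding fin_blaschke_def moeb_def
  by (intro continuous_intros) (use assms moeb_denom_nz in \<open>auto simp: unit_disc_def\<close>)

text \<open>For |t| = 1 one has \<open>1 - cnj a * t = t * cnj (t - a)\<close>, so numerator and
  denominator have equal modulus. With continuity on the closed disc this keeps the sets where the
  modulus is at most s < 1 compact inside the open disc.\<close>

lemma norm_fin_blaschke_sphere:
  assumes "\<forall>i\<in>I. a i \<in> unit_disc" "cmod t = 1"
  shows "cmod (fin_blaschke I a mu t) = 1"
proof -
  have "cmod (moeb (a i) t) = 1" if "i \<in> I" for i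
  proof -
    have nz: "1 - cnj (a i) * t \<noteq> 0" using moeb_denom_nz assms that by (auto simp: unit_disc_def)
    have "t * cnj t = 1" using assms by (simp add: complex_norm_square[symmetric])
    then have "1 - cnj (a i) * t = - (t * cnj (a i - t))" by (simp add: right_diff_distrib)
    then have "cmod (1 - cnj (a i) * t) = cmod t * cmod (cnj (a i - t))"
      by (simp only: norm_minus_cancel norm_mult)
    then have "cmod (1 - cnj (a i) * t) = cmod (a i - t)"
      using assms(2) by (simp only: complex_mod_cnj mult_1_left)
    moreover from this have "cmod (a i - t) \<noteq> 0" using nz by (metis norm_eq_zero)
    ultimately show ?thesis by (simp add: moeb_def norm_divide)
  qed
  then show ?thesis by (simp add: fin_blaschke_def prod_norm[symmetric] norm_power)
qed

lemma elog_scale: "r > 0 \<Longrightarrow> elog (of_real r * x) = elog x + ereal (ln r)"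
  by (simp add: elog_mult add.commute) (simp add: elog_def)

text \<open>Converse to \<open>elog_fin_blaschke_le\<close>: injectivity of \<zeta> keeps the other
  factors away from 0 near \<open>\<zeta> j\<close>, and the denominator of the \<open>j\<close>-th
  factor has modulus at most 2.\<close>

lemma elog_le_fin_blaschke:
  assumes I: "finite I" "j \<in> I" and ze: "\<forall>i\<in>I. \<zeta> i \<in> unit_disc" "inj_on \<zeta> I" and mu: "\<forall>i\<in>I. mu i \<ge> 1"
  obtains C \<rho> where "\<rho> > 0" "\<And>t. t \<in> unit_disc \<Longrightarrow> dist t (\<zeta> j) < \<rho> \<Longrightarrow>
      ereal (real (mu j)) * elog (t - \<zeta> j) \<le> elog (fin_blaschke I \<zeta> mu t) + ereal C"
proof -
  define g where "g = fin_blaschke (I - {j}) \<zeta> mu"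
  have split: "fin_blaschke I \<zeta> mu t = moeb (\<zeta> j) t ^ mu j * g t" for t
    unfolding fin_blaschke_def g_def using I by (simp add: prod.remove)
  have gj: "g (\<zeta> j) \<noteq> 0"
    unfolding g_def using assms by (subst fin_blaschke_eq_0_iff) (auto simp: inj_on_def)
  have "continuous_on unit_disc g"
    unfolding g_def using ze by (intro holomorphic_on_imp_continuous_on fin_blaschke_holomorphic) auto
  then have "isCont g (\<zeta> j)"
    using ze I by (simp add: continuous_on_eq_continuous_at unit_disc_def)
  then obtain \<rho> where \<rho>: "\<rho> > 0" "\<And>t. dist t (\<zeta> j) < \<rho> \<Longrightarrow> dist (g t) (g (\<zeta> j)) < cmod (g (\<zeta> j)) / 2"
    using gj unfolding continuous_at_eps_delta by (metis half_gt_zero zero_less_norm_iff)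
  define b where "b = cmod (g (\<zeta> j)) / 2"
  have b: "b > 0" using gj by (simp add: b_def)
  show thesis
  proof (rule that[OF \<rho>(1)])
    fix t assume t: "t \<in> unit_disc" "dist t (\<zeta> j) < \<rho>"
    have "b \<le> cmod (g t)"
      using \<rho>(2)[OF t(2)] norm_triangle_ineq2[of "g (\<zeta> j)" "g t"] by (simp add: b_def dist_norm norm_minus_commute)
    moreover have "cmod (t - \<zeta> j) / 2 \<le> cmod (moeb (\<zeta> j) t)"
    proof -
      have "cmod (cnj (\<zeta> j) * t) \<le> 1"
        using t ze I less_imp_le[of "cmod t" 1] less_imp_le[of "cmod (\<zeta> j)" 1]
        by (simp add: norm_mult unit_disc_def mult_le_one)
      then have "cmod (1 - cnj (\<zeta> j) * t) \<le> 2" using norm_triangle_ineq4[of 1 "cnj (\<zeta> j) * t"] by simp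
      moreover have "1 - cnj (\<zeta> j) * t \<noteq> 0" using t ze I moeb_denom_nz by (auto simp: unit_disc_def)
      ultimately show ?thesis
        unfolding moeb_def norm_divide by (subst norm_minus_commute) (intro divide_left_mono, auto)
    qed
    ultimately have "(cmod (t - \<zeta> j) / 2) ^ mu j * b \<le> cmod (moeb (\<zeta> j) t) ^ mu j * cmod (g t)"
      using b by (intro mult_mono power_mono) auto
    then have "cmod ((t - \<zeta> j) ^ mu j) \<le> 2 ^ mu j / b * cmod (fin_blaschke I \<zeta> mu t)"
      using b unfolding split by (simp add: norm_mult norm_power power_divide field_simps)
    then have "cmod ((t - \<zeta> j) ^ mu j) \<le> cmod (of_real (2 ^ mu j / b) * fin_blaschke I \<zeta> mu t)"
      unfolding norm_mult norm_of_real using b by simp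
    then show "ereal (real (mu j)) * elog (t - \<zeta> j) \<le> elog (fin_blaschke I \<zeta> mu t) + ereal (ln (2 ^ mu j / b))"
    proof -
      have "0 < 2 ^ mu j / b" using b by simp
      from \<open>cmod _ \<le> cmod (of_real _ * _)\<close> show ?thesis
        unfolding elog_le_iff[symmetric] elog_power elog_scale[OF \<open>0 < 2 ^ mu j / b\<close>] .
    qed
  qed
qed

lemma Psi_0: "m \<ge> 1 \<Longrightarrow> Psi m 0 = - \<infinity>"
  by (simp add: Psi_def)

lemma Psi_le_MInfty: "Psi m x \<le> - \<infinity> \<Longrightarrow> x = 0"
proof -
  assume "Psi m x \<le> - \<infinity>"
  then have "ereal (real m) * elog (fst x) \<le> - \<infinity>" "elog (snd x) \<le> - \<infinity>"
    by (simp_all only: Psi_def max.bounded_iff)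
  then show "x = 0" by (auto simp: elog_def prod_eq_iff split: if_splits)
qed

text \<open>Pole condition and contact order combine to a bound of \<open>u (\<phi> t)\<close> by
  log|f(t)| plus a constant near each \<open>\<zeta> j\<close>. In the majorant
  \<open>(1 - e) * ln (cmod (f t)) + e\<close> the weight \<open>1 - e\<close> absorbs the constant
  close to the zeros, and the summand \<open>e\<close> gives room near the unit circle; finally e
  tends to 0.\<close>

lemma neg_psh_disc_le:
  assumes I: "finite I" and p: "inj_on p I" and mu: "\<forall>i\<in>I. mu i \<ge> 1"
    and u: "neg_psh u" "has_poles I p mu u" and phi: "holo_disc \<phi>"
    and ze: "\<forall>i\<in>I. \<zeta> i \<in> unit_disc"
    and ord: "\<forall>j\<in>I. \<exists>C::real. \<exists>\<epsilon>>0. \<forall>t\<in>unit_disc. dist t (\<zeta> j) < \<epsilon> \<longrightarrow>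
            Psi (mu j) (\<phi> t - p j) \<le> ereal (real (mu j)) * elog (t - \<zeta> j) + ereal C"
  shows "u (\<phi> 0) \<le> (\<Sum>j\<in>I. ereal (real (mu j)) * elog (\<zeta> j))"
proof -
  define f where "f = fin_blaschke I \<zeta> mu"
  have "elog (f 0) = (\<Sum>j\<in>I. ereal (real (mu j)) * elog (\<zeta> j))"
    unfolding f_def elog_fin_blaschke[OF I] by simp
  moreover have "u (\<phi> 0) \<le> elog (f 0)"
  proof -
    have phiD: "\<phi> t \<in> bidisc" if "t \<in> unit_disc" for t using phi that by (auto simp: holo_disc_def)
    have u0: "u x < 0" if "x \<in> bidisc" for x using u that by (simp add: neg_psh_def)
    have z0: "0 \<in> unit_disc" by (simp add: unit_disc_def)
    \<comment> \<open>At \<open>t = \<zeta> j\<close> the contact condition bounds the indicator by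
      -\<infinity>, a value it takes only at the origin.\<close>
    have hit: "\<phi> (\<zeta> j) = p j" if "j \<in> I" for j
    proof -
      obtain C \<epsilon> where "\<epsilon> > 0" "\<forall>t\<in>unit_disc. dist t (\<zeta> j) < \<epsilon> \<longrightarrow>
            Psi (mu j) (\<phi> t - p j) \<le> ereal (real (mu j)) * elog (t - \<zeta> j) + ereal C"
        using ord \<open>j \<in> I\<close> by blast
      then have "Psi (mu j) (\<phi> (\<zeta> j) - p j) \<le> ereal (real (mu j)) * elog (\<zeta> j - \<zeta> j) + ereal C"
        using ze \<open>j \<in> I\<close> by force
      also have "\<dots> = - \<infinity>"
      proof -
        have "mu j > 0" using mu \<open>j \<in> I\<close> by force
        then show ?thesis by simp
      qed
      finally have "\<phi> (\<zeta> j) - p j = 0" by (rule Psi_le_MInfty)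
      then show ?thesis by simp
    qed
    have inj: "inj_on \<zeta> I" using p hit by (metis inj_on_def)
    have near: "\<exists>C::real. \<exists>\<rho>>0. \<forall>t\<in>unit_disc. dist t (\<zeta> j) < \<rho> \<longrightarrow> u (\<phi> t) \<le> elog (f t) + ereal C"
      if j: "j \<in> I" for j
    proof -
      obtain C1 \<epsilon>1 where 1: "\<epsilon>1 > 0" "\<And>x. x \<in> bidisc \<Longrightarrow> dist x (p j) < \<epsilon>1 \<Longrightarrow> u x \<le> Psi (mu j) (x - p j) + ereal C1"
        using u(2) j unfolding has_poles_def by blast
      obtain C2 \<epsilon>2 where 2: "\<epsilon>2 > 0" "\<And>t. t \<in> unit_disc \<Longrightarrow> dist t (\<zeta> j) < \<epsilon>2 \<Longrightarrow>
            Psi (mu j) (\<phi> t - p j) \<le> ereal (real (mu j)) * elog (t - \<zeta> j) + ereal C2"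
        using ord j by blast
      obtain C3 \<epsilon>3 where 3: "\<epsilon>3 > 0" "\<And>t. t \<in> unit_disc \<Longrightarrow> dist t (\<zeta> j) < \<epsilon>3 \<Longrightarrow>
            ereal (real (mu j)) * elog (t - \<zeta> j) \<le> elog (f t) + ereal C3"
        using elog_le_fin_blaschke[OF I j ze inj mu] unfolding f_def by blast
      have "isCont \<phi> (\<zeta> j)"
        using holo_disc_continuous_on[OF phi] ze j by (simp add: continuous_on_eq_continuous_at unit_disc_def)
      then obtain \<epsilon>4 where 4: "\<epsilon>4 > 0" "\<And>t. dist t (\<zeta> j) < \<epsilon>4 \<Longrightarrow> dist (\<phi> t) (p j) < \<epsilon>1"
        using 1(1) hit[OF j] unfolding continuous_at_eps_delta by metis
      have "u (\<phi> t) \<le> elog (f t) + ereal (C3 + C2 + C1)"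
        if t: "t \<in> unit_disc" "dist t (\<zeta> j) < min \<epsilon>2 (min \<epsilon>3 \<epsilon>4)" for t
      proof -
        have "u (\<phi> t) \<le> Psi (mu j) (\<phi> t - p j) + ereal C1"
          using t by (intro 1(2) 4(2) phiD) auto
        also have "\<dots> \<le> ereal (real (mu j)) * elog (t - \<zeta> j) + ereal C2 + ereal C1"
          using t by (intro add_right_mono 2(2)) auto
        also have "\<dots> \<le> elog (f t) + ereal C3 + ereal C2 + ereal C1"
          using t by (intro add_right_mono 3(2)) auto
        finally show ?thesis by (simp add: add.assoc)
      qed
      then show ?thesis using 2(1) 3(1) 4(1)
        by (intro exI[of _ "C3 + C2 + C1"] exI[of _ "min \<epsilon>2 (min \<epsilon>3 \<epsilon>4)"]) auto
    qed
    show ?thesis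
    proof (cases "f 0 = 0")
      case True
      then obtain j where j: "j \<in> I" "\<zeta> j = 0"
        using fin_blaschke_eq_0_iff[OF I ze z0 mu] by (auto simp: f_def)
      obtain C \<epsilon> where "\<epsilon> > 0" "\<forall>x\<in>bidisc. dist x (p j) < \<epsilon> \<longrightarrow> u x \<le> Psi (mu j) (x - p j) + ereal C"
        using u(2) j unfolding has_poles_def by blast
      moreover have "\<phi> 0 = p j" using hit j by metis
      ultimately have "u (\<phi> 0) \<le> Psi (mu j) 0 + ereal C" using phiD[OF z0] by auto
      then show ?thesis using Psi_0 mu j by simp
    next
      case False
      obtain C \<rho> where near': "\<And>j. j \<in> I \<Longrightarrow> \<rho> j > (0::real)"
        "\<And>j t. j \<in> I \<Longrightarrow> t \<in> unit_disc \<Longrightarrow> dist t (\<zeta> j) < \<rho> j \<Longrightarrow> u (\<phi> t) \<le> elog (f t) + ereal (C j)"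
        using near by metis
      define C' where "C' = (\<Sum>j\<in>I. \<bar>C j\<bar>)"
      have C': "C j \<le> C'" if "j \<in> I" for j
        using member_le_sum[of j I "\<lambda>j. \<bar>C j\<bar>"] I that by (auto simp: C'_def)
      have contf: "continuous_on (cball 0 1) f" unfolding f_def by (rule continuous_on_fin_blaschke[OF ze])
      have main: "u (\<phi> 0) \<le> ereal ((1 - e) * ln (cmod (f 0)) + e)" if e: "0 < e" "e < 1" for e :: real
      proof -
        \<comment> \<open>The level at which the majorant vanishes: for |f| at least
          \<open>s\<close> the bound follows from u < 0.\<close>
        define s where "s = exp (- e / (1 - e))"
        have s: "0 < s" "s < 1" "(1 - e) * ln s + e = 0" using e by (auto simp: s_def)
        show ?thesis
        proof (cases "cmod (f 0) \<ge> s")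
          case True
          then have "ln s \<le> ln (cmod (f 0))" using s by (intro ln_mono)
          then have "(1 - e) * ln s \<le> (1 - e) * ln (cmod (f 0))" using e by (intro mult_left_mono) auto
          then have "0 \<le> (1 - e) * ln (cmod (f 0)) + e" using s(3) by linarith
          then show ?thesis using u0[OF phiD[OF z0]] by (metis ereal_less_eq(5) less_imp_le order_trans)
        next
          case nS: False
          \<comment> \<open>Off the neighbourhoods of the zeros |f| has a positive lower bound
            \<open>\<sigma>1\<close>, so a point of the disc with smaller |f| lies in one of
            them.\<close>
          define Q where "Q = cball 0 1 - (\<Union>j\<in>I. ball (\<zeta> j) (\<rho> j))"
          have "compact Q" unfolding Q_def by (intro compact_diff compact_cball open_UN ballI open_ball)
          have Qnz: "f t \<noteq> 0" if "t \<in> Q" for t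
          proof (cases "t \<in> unit_disc")
            case True
            have "t \<notin> \<zeta> ` I" using that near'(1) by (force simp: Q_def)
            then show ?thesis using fin_blaschke_eq_0_iff[OF I ze True mu] by (simp add: f_def)
          next
            case False
            then have "cmod t = 1" using that by (auto simp: Q_def unit_disc_def)
            then show ?thesis using norm_fin_blaschke_sphere[OF ze, of t mu] by (auto simp: f_def)
          qed
          obtain \<sigma>1 where \<sigma>1: "\<sigma>1 > 0" "\<And>t. t \<in> Q \<Longrightarrow> \<sigma>1 \<le> cmod (f t)"
          proof (cases "Q = {}")
            case False
            have "continuous_on Q (\<lambda>t. cmod (f t))"
              by (intro continuous_intros continuous_on_subset[OF contf]) (auto simp: Q_def)
            from continuous_attains_inf[OF \<open>compact Q\<close> False this] obtain q where
              "q \<in> Q" "\<forall>t\<in>Q. cmod (f q) \<le> cmod (f t)" by blast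
            then show ?thesis using that[of "cmod (f q)"] Qnz by auto
          qed (use that[of 1] in auto)
          \<comment> \<open>The exponential forces \<open>e * ln \<sigma> \<le> - C'\<close>, hence
            \<open>ln \<sigma> + C j < (1 - e) * ln \<sigma> + e\<close>. The other terms ensure
            \<open>\<sigma> < \<sigma>1\<close> and \<open>0 \<in> K\<close>.\<close>
          define \<sigma> where "\<sigma> = min (min (\<sigma>1 / 2) (exp ((e - C') / e - 1))) (cmod (f 0))"
          have \<sigma>: "\<sigma> > 0" "\<sigma> < \<sigma>1" "\<sigma> \<le> exp ((e - C') / e - 1)" "\<sigma> \<le> cmod (f 0)"
            using \<sigma>1 False by (auto simp: \<sigma>_def)
          define K where "K = {t \<in> cball 0 1. cmod (f t) \<in> {\<sigma>..s}}"
          have "closed K" unfolding K_def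
          proof -
            have "closed (cball 0 1 \<inter> (\<lambda>t. cmod (f t)) -` {\<sigma>..s})"
              by (intro continuous_closed_preimage continuous_intros contf) auto
            then show "closed {t \<in> cball 0 1. cmod (f t) \<in> {\<sigma>..s}}" by (simp add: Int_def vimage_def)
          qed
          moreover have "bounded K" by (rule bounded_subset[OF bounded_cball[of 0 1]]) (auto simp: K_def)
          ultimately have K: "compact K" by (simp add: compact_eq_bounded_closed)
          have KD: "K \<subseteq> unit_disc"
          proof
            fix t assume t: "t \<in> K"
            then have "cmod t \<noteq> 1" using norm_fin_blaschke_sphere[OF ze, of t mu] s by (auto simp: K_def f_def)
            then show "t \<in> unit_disc" using t by (auto simp: K_def unit_disc_def)
          qed
          show ?thesis
          proof (rule disc_maximum_principle[OF u(1) phi K KD])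
            show "f holomorphic_on unit_disc" unfolding f_def by (rule fin_blaschke_holomorphic[OF ze])
            show "f t \<noteq> 0" if "t \<in> K" for t using that \<sigma> by (auto simp: K_def)
            show "0 \<in> K" using \<sigma> nS by (auto simp: K_def)
            fix t assume t: "t \<in> K - interior K"
            then have tD: "t \<in> unit_disc" using KD by blast
            \<comment> \<open>Points of \<open>K\<close> with both inequalities strict have an open
              neighbourhood in \<open>K\<close>, as they lie in the open disc.\<close>
            have "cmod (f t) = \<sigma> \<or> cmod (f t) = s"
            proof (rule ccontr)
              assume "\<not> ?thesis"
              then have tt: "cmod (f t) \<in> {\<sigma><..<s}" using t by (auto simp: K_def)
              have "open (unit_disc \<inter> (\<lambda>t. cmod (f t)) -` {\<sigma><..<s})"
                by (intro continuous_open_preimage continuous_intros continuous_on_subset[OF contf])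
                  (auto simp: unit_disc_def)
              moreover have "unit_disc \<inter> (\<lambda>t. cmod (f t)) -` {\<sigma><..<s} \<subseteq> K"
                by (auto simp: K_def unit_disc_def)
              ultimately have "t \<in> interior K" using tt tD by (intro interiorI) auto
              then show False using t by blast
            qed
            then show "u (\<phi> t) < ereal ((1 - e) * ln (cmod (f t)) + e)"
            proof
              assume "cmod (f t) = s"
              then show ?thesis using s(3) u0[OF phiD[OF tD]] by (simp add: zero_ereal_def)
            next
              assume ft: "cmod (f t) = \<sigma>"
              then have "t \<notin> Q" using \<sigma>1 \<sigma> by force
              then obtain j where j: "j \<in> I" "dist t (\<zeta> j) < \<rho> j"
                using tD by (auto simp: Q_def unit_disc_def dist_commute)
              have "u (\<phi> t) \<le> elog (f t) + ereal (C j)" by (rule near'(2)[OF j(1) tD j(2)])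
              also have "\<dots> = ereal (ln \<sigma> + C j)" using ft \<sigma> by (auto simp: elog_def)
              also have "\<dots> < ereal ((1 - e) * ln \<sigma> + e)"
              proof -
                have "ln \<sigma> \<le> (e - C') / e - 1"
                  using \<sigma> by (metis ln_exp ln_mono)
                then have "e * ln \<sigma> \<le> e * ((e - C') / e - 1)" using e by (intro mult_left_mono) auto
                also have "\<dots> = - C'" using e by (simp add: field_simps)
                finally show ?thesis using C'[OF j(1)] e by (simp add: left_diff_distrib)
              qed
              finally show ?thesis using ft by simp
            qed
          qed
        qed
      qed
      have "(\<lambda>n. ereal ((1 - 1 / real (n + 2)) * ln (cmod (f 0)) + 1 / real (n + 2))) \<longlonglongrightarrow> ereal ((1 - 0) * ln (cmod (f 0)) + 0)"
      proof -
        have "(\<lambda>n. 1 / real (n + 2)) \<longlonglongrightarrow> 0" by real_asymp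
        then show ?thesis by (intro tendsto_intros)
      qed
      then have "u (\<phi> 0) \<le> ereal ((1 - 0) * ln (cmod (f 0)) + 0)"
        by (rule tendsto_lowerbound) (auto intro!: always_eventually main)
      then show ?thesis using False by (simp add: elog_def)
    qed
  qed
  ultimately show ?thesis by simp
qed

lemma green_le_lempert:
  assumes "finite I" "inj_on p I" "\<forall>i\<in>I. mu i \<ge> 1"
  shows "green I p mu z \<le> lempert I p mu z"
  unfolding green_def lempert_def
  by (intro Sup_least Inf_greatest) (use neg_psh_disc_le[OF assms] in blast)

section \<open>Discs realising the bound on the Lempert function\<close>

text \<open>The second component is a multiple of the Blaschke product with zeros \<zeta>, which has
  the required contact; in the first, \<open>h\<close> is Lipschitz at \<open>\<zeta> j\<close>.
  Hypothesis \<open>le\<close> lets the multiple prescribed by \<open>\<phi> 0 = z\<close> have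
  modulus at most 1.\<close>

lemma lempert_le_of_interpolation:
  assumes I: "finite I" and mu: "\<forall>i\<in>I. mu i \<ge> 1" and z: "z \<in> bidisc"
    and h: "h holomorphic_on unit_disc" "h ` unit_disc \<subseteq> unit_disc" "h 0 = fst z"
    and ze: "\<forall>i\<in>I. \<zeta> i \<in> unit_disc" "\<forall>i\<in>I. h (\<zeta> i) = a i"
    and le: "cmod (snd z) \<le> cmod (\<Prod>i\<in>I. \<zeta> i ^ mu i)"
  shows "lempert I (\<lambda>i. (a i, 0)) mu z \<le> elog (\<Prod>i\<in>I. \<zeta> i ^ mu i)"
proof -
  define f where "f = fin_blaschke I \<zeta> mu"
  \<comment> \<open>If the product is 0, \<open>le\<close> forces \<open>snd z = 0\<close> and
    division by 0 gives \<open>c = 0\<close>, so \<open>c0\<close> still holds.\<close>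
  define c where "c = snd z / (\<Prod>i\<in>I. \<zeta> i ^ mu i)"
  define \<phi> where "\<phi> t = (h t, c * f t)" for t
  have c1: "cmod c \<le> 1" using le by (simp add: c_def norm_divide divide_le_eq_1)
  have c0: "c * (\<Prod>i\<in>I. \<zeta> i ^ mu i) = snd z"
    using le by (cases "(\<Prod>i\<in>I. \<zeta> i ^ mu i) = 0") (auto simp: c_def)
  have f1: "cmod (f t) \<le> 1" if "t \<in> unit_disc" for t
    unfolding f_def by (rule norm_fin_blaschke_le[OF ze(1) that])
  have cf: "cmod (c * f t) < 1" if t: "t \<in> unit_disc" for t
  proof (cases "I = {}")
    case True
    then have "c * f t = snd z" using c0 by (simp add: f_def fin_blaschke_def)
    then show ?thesis using z by (simp add: bidisc_def)
  next
    case False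
    have "cmod c * cmod (f t) \<le> 1 * cmod (f t)" by (intro mult_right_mono c1) auto
    also have "\<dots> < 1" using norm_fin_blaschke_less[OF I ze(1) t False mu] by (simp add: f_def)
    finally show ?thesis by (simp add: norm_mult)
  qed
  have "(\<lambda>t. c * f t) holomorphic_on unit_disc"
    unfolding f_def using fin_blaschke_holomorphic[OF ze(1)] by (intro holomorphic_intros)
  then have "holo_disc \<phi>"
    using h cf by (auto simp: holo_disc_def \<phi>_def o_def bidisc_def unit_disc_def)
  moreover have "\<phi> 0 = z" using h c0 by (simp add: \<phi>_def f_def)
  moreover have "\<exists>C::real. \<exists>\<epsilon>>0. \<forall>t\<in>unit_disc. dist t (\<zeta> j) < \<epsilon> \<longrightarrow>
            Psi (mu j) (\<phi> t - (a j, 0)) \<le> ereal (real (mu j)) * elog (t - \<zeta> j) + ereal C"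
    if j: "j \<in> I" for j
  proof -
    have "open unit_disc" "\<zeta> j \<in> unit_disc" using ze j by (auto simp: unit_disc_def)
    then obtain d r where d: "r > 0" "\<And>l. cmod l < r \<Longrightarrow> cmod (h (\<zeta> j + l) - h (\<zeta> j) - l * d) \<le> 1 * cmod l"
      using linear_approx[OF h(1), of "\<zeta> j" 1] by (metis zero_less_one)
    \<comment> \<open>Local Lipschitz constant of \<open>h\<close> at \<open>\<zeta> j\<close>:
      modulus of the derivative plus the error 1 allowed above.\<close>
    define B where "B = 1 + cmod d"
    have B: "B > 0" "ln B \<ge> 0" by (auto simp: B_def add_pos_nonneg)
    define C2 where "C2 = real (mu j) * ln (1 / (1 - cmod (\<zeta> j)))"
    define C where "C = max (real (mu j) * ln B) C2"
    have "Psi (mu j) (\<phi> t - (a j, 0)) \<le> ereal (real (mu j)) * elog (t - \<zeta> j) + ereal C"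
      if t: "t \<in> unit_disc" "dist t (\<zeta> j) < r" for t
    proof -
      have "cmod (h t - a j) \<le> cmod (of_real B * (t - \<zeta> j))"
      proof -
        have "cmod (h t - a j - (t - \<zeta> j) * d) \<le> cmod (t - \<zeta> j)"
          using d(2)[of "t - \<zeta> j"] t ze j by (simp add: dist_norm)
        moreover have "cmod (h t - a j) \<le> cmod (h t - a j - (t - \<zeta> j) * d) + cmod ((t - \<zeta> j) * d)"
          using norm_triangle_ineq[of "h t - a j - (t - \<zeta> j) * d" "(t - \<zeta> j) * d"] by simp
        moreover have "cmod (of_real B * (t - \<zeta> j)) = cmod (t - \<zeta> j) + cmod ((t - \<zeta> j) * d)"
          unfolding norm_mult norm_of_real using B(1) by (simp add: B_def algebra_simps)
        ultimately show ?thesis by linarith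
      qed
      then have "cmod ((h t - a j) ^ mu j) \<le> cmod ((of_real B * (t - \<zeta> j)) ^ mu j)"
        unfolding norm_power by (intro power_mono) auto
      then have "elog ((h t - a j) ^ mu j) \<le> elog (of_real (B ^ mu j) * (t - \<zeta> j) ^ mu j)"
        by (simp add: elog_le_iff power_mult_distrib)
      also have "\<dots> = ereal (real (mu j)) * elog (t - \<zeta> j) + ereal (real (mu j) * ln B)"
        using B by (subst elog_scale) (simp_all add: elog_power ln_realpow)
      also have "\<dots> \<le> ereal (real (mu j)) * elog (t - \<zeta> j) + ereal C"
        by (intro add_left_mono) (simp add: C_def)
      finally have 1: "ereal (real (mu j)) * elog (h t - a j) \<le> ereal (real (mu j)) * elog (t - \<zeta> j) + ereal C"
        by (simp add: elog_power)
      have "cmod (c * f t) \<le> cmod (f t)" using c1 by (simp add: norm_mult mult_left_le_one_le)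
      then have "elog (c * f t) \<le> elog (f t)" by (simp add: elog_le_iff)
      also have "\<dots> \<le> ereal (real (mu j)) * elog (t - \<zeta> j) + ereal C2"
        unfolding f_def C2_def by (rule elog_fin_blaschke_le[OF I j ze(1) t(1)])
      also have "\<dots> \<le> ereal (real (mu j)) * elog (t - \<zeta> j) + ereal C"
        by (intro add_left_mono) (simp add: C_def)
      finally show ?thesis using 1 by (simp add: Psi_def \<phi>_def)
    qed
    then show ?thesis using d(1) by blast
  qed
  ultimately have "lempert I (\<lambda>i. (a i, 0)) mu z \<le> (\<Sum>j\<in>I. ereal (real (mu j)) * elog (\<zeta> j))"
    unfolding lempert_def using ze(1) by (intro Inf_lower) blast
  then show ?thesis by (simp add: elog_prod_power[OF I])
qed

text \<open>The roots solve \<open>\<zeta> \<phi>\<^sub>c(\<zeta>) = \<alpha>\<close> (see \<open>mult_moeb_eq_iff\<close>). A root itself need not depend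
  continuously on \<open>c\<close>, but the smaller modulus does; the root product \<open>\<alpha>\<close> keeps it below \<open>\<bar>\<alpha>\<bar>\<^sup>1\<^sup>/\<^sup>2\<close>.\<close>
lemma quadratic_small_root:
  fixes \<alpha> :: complex
  obtains \<rho> :: "real \<Rightarrow> real" where "continuous_on UNIV \<rho>"
    "\<And>c. \<exists>\<zeta>. cmod \<zeta> = \<rho> c \<and> \<zeta>\<^sup>2 - of_real c * (1 + \<alpha>) * \<zeta> + \<alpha> = 0 \<and> (cmod \<zeta>)\<^sup>2 \<le> cmod \<alpha>"
proof -
  define X where "X c = of_real c * (1 + \<alpha>)" for c
  \<comment> \<open>Let A and B be twice the moduli of the two roots. Then
    \<open>A * B = 4 * cmod \<alpha>\<close>, and \<open>A^2 + B^2 = S c\<close> by the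
    parallelogram law. The radicals below are \<open>A + B\<close> and |A - B|, so
    \<open>\<rho> c\<close> is \<open>min A B / 2\<close>, free of a choice of branch.\<close>
  define S where "S c = 2 * (cmod (X c))\<^sup>2 + 2 * cmod ((X c)\<^sup>2 - 4 * \<alpha>)" for c
  define \<rho> where "\<rho> c = (sqrt (S c + 8 * cmod \<alpha>) - sqrt (S c - 8 * cmod \<alpha>)) / 4" for c
  have "continuous_on UNIV X"
    unfolding X_def by (intro continuous_on_mult continuous_on_of_real continuous_on_id continuous_on_const)
  then have "continuous_on UNIV S"
    unfolding S_def
    by (intro continuous_on_add continuous_on_mult continuous_on_power continuous_on_norm
        continuous_on_diff continuous_on_const)
  then have cont: "continuous_on UNIV \<rho>"
    unfolding \<rho>_def
    by (intro continuous_on_divide continuous_on_diff continuous_on_real_sqrt continuous_on_add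
        continuous_on_const) auto
  have root: "\<exists>\<zeta>. cmod \<zeta> = \<rho> c \<and> \<zeta>\<^sup>2 - of_real c * (1 + \<alpha>) * \<zeta> + \<alpha> = 0 \<and> (cmod \<zeta>)\<^sup>2 \<le> cmod \<alpha>" for c
  proof -
    define s where "s = csqrt ((X c)\<^sup>2 - 4 * \<alpha>)"
    have s2: "s\<^sup>2 = (X c)\<^sup>2 - 4 * \<alpha>" by (simp add: s_def)
    define A where "A = cmod (X c + s)"
    define B where "B = cmod (X c - s)"
    have prod: "(X c + s) * (X c - s) = 4 * \<alpha>"
    proof -
      have "(X c + s) * (X c - s) = (X c)\<^sup>2 - s\<^sup>2" by (simp add: power2_eq_square algebra_simps)
      then show ?thesis by (simp add: s2)
    qed
    have "A * B = cmod ((X c + s) * (X c - s))" by (simp add: A_def B_def norm_mult)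
    also have "\<dots> = 4 * cmod \<alpha>" unfolding prod by (simp add: norm_mult)
    finally have AB: "A * B = 4 * cmod \<alpha>" .
    have "A\<^sup>2 + B\<^sup>2 = 2 * (cmod (X c))\<^sup>2 + 2 * (cmod s)\<^sup>2"
      unfolding A_def B_def cmod_power2 by (simp add: power2_eq_square algebra_simps)
    also have "(cmod s)\<^sup>2 = cmod ((X c)\<^sup>2 - 4 * \<alpha>)" unfolding norm_power[symmetric] s2 ..
    finally have sq: "A\<^sup>2 + B\<^sup>2 = S c" by (simp add: S_def)
    have AB0: "0 \<le> A" "0 \<le> B" by (simp_all add: A_def B_def)
    have "sqrt (S c + 8 * cmod \<alpha>) = A + B"
      using AB sq by (intro real_sqrt_unique) (auto simp: power2_sum AB0)
    moreover have "sqrt (S c - 8 * cmod \<alpha>) = \<bar>A - B\<bar>"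
      using AB sq by (intro real_sqrt_unique) (auto simp: power2_diff)
    ultimately have \<rho>: "\<rho> c = min A B / 2" by (auto simp: \<rho>_def min_def)
    have "(min A B)\<^sup>2 \<le> A * B"
      unfolding power2_eq_square by (intro mult_mono) (auto simp: AB0)
    then have le: "(\<rho> c)\<^sup>2 \<le> cmod \<alpha>" using AB by (simp add: \<rho> power_divide)
    have root: "\<zeta>\<^sup>2 - of_real c * (1 + \<alpha>) * \<zeta> + \<alpha> = 0" if "2 * \<zeta> = X c + s \<or> 2 * \<zeta> = X c - s" for \<zeta>
    proof -
      from that have "2 * \<zeta> - X c = s \<or> 2 * \<zeta> - X c = - s"
        by (elim disjE) simp_all
      then have "(2 * \<zeta> - X c)\<^sup>2 = s\<^sup>2" by auto
      moreover have "4 * (\<zeta>\<^sup>2 - X c * \<zeta> + \<alpha>) = (2 * \<zeta> - X c)\<^sup>2 - ((X c)\<^sup>2 - 4 * \<alpha>)"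
        by (simp add: power2_eq_square algebra_simps)
      ultimately have "4 * (\<zeta>\<^sup>2 - X c * \<zeta> + \<alpha>) = 0" by (simp only: s2 diff_self)
      then have "\<zeta>\<^sup>2 - X c * \<zeta> + \<alpha> = 0" by (metis mult_eq_0_iff zero_neq_numeral)
      then show ?thesis by (simp only: X_def)
    qed
    show ?thesis
    proof (cases "A \<le> B")
      case True
      then show ?thesis using le root[of "(X c + s) / 2"]
        by (intro exI[of _ "(X c + s) / 2"]) (auto simp: \<rho> norm_divide A_def[symmetric])
    next
      case False
      then show ?thesis using le root[of "(X c - s) / 2"]
        by (intro exI[of _ "(X c - s) / 2"]) (auto simp: \<rho> norm_divide B_def[symmetric])
    qed
  qed
  show thesis by (rule that[OF cont root])
qed

section \<open>Lifting points through self-maps of the disc\<close>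

definition self_map :: "(complex \<Rightarrow> complex) \<Rightarrow> bool" where
  "self_map k \<longleftrightarrow> k holomorphic_on unit_disc \<and> k ` unit_disc \<subseteq> unit_disc \<and> k 0 = 0"

lemma self_map_comp: "self_map k \<Longrightarrow> self_map l \<Longrightarrow> self_map (k \<circ> l)"
  unfolding self_map_def by (auto intro!: holomorphic_on_compose_gen)

lemma self_map_id: "self_map (\<lambda>x. x)"
  by (auto simp: self_map_def)

lemma self_map_square: "self_map (\<lambda>x. x\<^sup>2)"
  by (auto simp: self_map_def unit_disc_def norm_power power_less_one_iff intro!: holomorphic_intros)

text \<open>For c = 1 the Moebius factor is 1 on the open disc and the map is the identity; for c =
  0 the map is \<open>- x^2\<close>. The family joins the two.\<close>

lemma self_map_mult_moeb:
  assumes c: "0 \<le> c" "c \<le> 1"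
  shows "self_map (\<lambda>x. x * moeb (of_real c) x)"
proof (cases "c = 1")
  case True
  have eq: "x * moeb (of_real c) x = x" if "x \<in> unit_disc" for x
    using that True by (auto simp: moeb_def unit_disc_def)
  then have "(\<lambda>x. x * moeb (of_real c) x) holomorphic_on unit_disc"
    by (subst holomorphic_cong[OF refl eq]) auto
  moreover have "(\<lambda>x. x * moeb (of_real c) x) ` unit_disc \<subseteq> unit_disc"
    by (intro image_subsetI) (simp only: eq)
  ultimately show ?thesis by (simp add: self_map_def)
next
  case False
  then have cD: "of_real c \<in> unit_disc" using c by (simp add: unit_disc_def)
  have "cmod (x * moeb (of_real c) x) < 1" if "x \<in> unit_disc" for x
  proof -
    have "cmod x * cmod (moeb (of_real c) x) \<le> cmod x"
      using moeb_norm_less[of "of_real c" x] cD that by (intro mult_left_le) (auto simp: unit_disc_def)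
    then show ?thesis using that by (simp add: norm_mult unit_disc_def)
  qed
  then show ?thesis
    using moeb_holomorphic[OF cD] by (auto simp: self_map_def unit_disc_def[symmetric] intro!: holomorphic_intros)
       (auto simp: unit_disc_def)
qed

lemma mult_moeb_eq_iff:
  assumes c: "0 \<le> c" "c \<le> 1" and x: "x \<in> unit_disc"
  shows "x * moeb (of_real c) x = \<alpha> \<longleftrightarrow> x\<^sup>2 - of_real c * (1 + \<alpha>) * x + \<alpha> = 0"
proof -
  have "cmod (of_real c * x) < 1"
    using c x mult_left_le_one_le[of "cmod x" c] by (simp add: norm_mult unit_disc_def)
  then have nz: "1 - of_real c * x \<noteq> 0" by (metis norm_one less_irrefl right_minus_eq)
  have "x * moeb (of_real c) x = \<alpha> \<longleftrightarrow> x * (of_real c - x) = \<alpha> * (1 - of_real c * x)"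
    using nz by (simp add: moeb_def divide_eq_eq)
  also have "\<dots> \<longleftrightarrow> x\<^sup>2 - of_real c * (1 + \<alpha>) * x + \<alpha> = 0"
    by (auto simp: power2_eq_square algebra_simps)
  finally show ?thesis .
qed

text \<open>For c = 1 the small root is \<open>\<alpha> i\<close> itself, for c = 0 its modulus is
  \<open>sqrt (cmod (\<alpha> i))\<close>. The product of the moduli thus runs continuously between
  its given value and the square root of it, and \<open>s\<close> lies in between.\<close>

lemma lift_points_between_root_and_value:
  fixes \<alpha> :: "'i \<Rightarrow> complex"
  assumes I: "finite I" and \<alpha>: "\<forall>i\<in>I. \<alpha> i \<in> unit_disc"
    and s: "0 < s" "(\<Prod>i\<in>I. cmod (\<alpha> i) ^ mu i) \<le> s" "s\<^sup>2 \<le> (\<Prod>i\<in>I. cmod (\<alpha> i) ^ mu i)"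
  obtains k \<zeta> where "self_map k" "\<forall>i\<in>I. \<zeta> i \<in> unit_disc \<and> k (\<zeta> i) = \<alpha> i" "(\<Prod>i\<in>I. cmod (\<zeta> i) ^ mu i) = s"
proof -
  have "\<forall>i. \<exists>\<rho> :: real \<Rightarrow> real. continuous_on UNIV \<rho> \<and>
    (\<forall>c. \<exists>\<zeta>. cmod \<zeta> = \<rho> c \<and> \<zeta>\<^sup>2 - of_real c * (1 + \<alpha> i) * \<zeta> + \<alpha> i = 0 \<and> (cmod \<zeta>)\<^sup>2 \<le> cmod (\<alpha> i))"
    by (metis quadratic_small_root)
  then obtain \<rho> where \<rho>: "\<And>i. continuous_on UNIV (\<rho> i)"
    "\<And>i c. \<exists>\<zeta>. cmod \<zeta> = \<rho> i c \<and> \<zeta>\<^sup>2 - of_real c * (1 + \<alpha> i) * \<zeta> + \<alpha> i = 0 \<and> (cmod \<zeta>)\<^sup>2 \<le> cmod (\<alpha> i)"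
    by metis
  then obtain Z where Z: "\<And>i c. cmod (Z i c) = \<rho> i c"
    "\<And>i c. (Z i c)\<^sup>2 - of_real c * (1 + \<alpha> i) * Z i c + \<alpha> i = 0" "\<And>i c. (cmod (Z i c))\<^sup>2 \<le> cmod (\<alpha> i)"
    by metis
  define g where "g c = (\<Prod>i\<in>I. \<rho> i c ^ mu i)" for c
  have ZD: "Z i c \<in> unit_disc" if "i \<in> I" for i c
  proof -
    have "(cmod (Z i c))\<^sup>2 < 1" using Z(3)[of i c] \<alpha> that by (force simp: unit_disc_def)
    then show ?thesis by (simp add: unit_disc_def power_less_one_iff)
  qed
  have cg: "continuous_on {0..1} g"
    unfolding g_def by (intro continuous_intros continuous_on_subset[OF \<rho>(1)]) auto
  have g1: "g 1 = (\<Prod>i\<in>I. cmod (\<alpha> i) ^ mu i)"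
    unfolding g_def
  proof (intro prod.cong refl)
    fix i assume i: "i \<in> I"
    \<comment> \<open>At c = 1 the quadratic factors, and its root 1 is outside the open
      disc.\<close>
    have "(Z i 1 - 1) * (Z i 1 - \<alpha> i) = 0" using Z(2)[of i 1] by (simp add: power2_eq_square algebra_simps)
    moreover have "Z i 1 \<noteq> 1" using ZD[OF i, of 1] by (auto simp: unit_disc_def)
    ultimately show "\<rho> i 1 ^ mu i = cmod (\<alpha> i) ^ mu i" using Z(1)[of i 1] by simp
  qed
  have "s \<le> g 0"
  proof -
    have "(g 0)\<^sup>2 = (\<Prod>i\<in>I. cmod (\<alpha> i) ^ mu i)"
      unfolding g_def prod_power_distrib
    proof (intro prod.cong refl)
      fix i
      have "(Z i 0)\<^sup>2 = - \<alpha> i" using Z(2)[of i 0] by (simp add: eq_neg_iff_add_eq_0)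
      then have "(\<rho> i 0)\<^sup>2 = cmod (\<alpha> i)" unfolding Z(1)[symmetric] norm_power[symmetric] by simp
      then show "(\<rho> i 0 ^ mu i)\<^sup>2 = cmod (\<alpha> i) ^ mu i"
        by (metis power_mult mult.commute)
    qed
    then have "s\<^sup>2 \<le> (g 0)\<^sup>2" using s by simp
    moreover have "0 \<le> g 0" unfolding g_def Z(1)[symmetric] by (intro prod_nonneg) auto
    ultimately show ?thesis by (rule power2_le_imp_le)
  qed
  moreover have "g 1 \<le> s" using s g1 by simp
  ultimately obtain c where c: "0 \<le> c" "c \<le> 1" "g c = s"
    using IVT2'[of g 1 s 0] cg by auto
  show thesis
  proof
    show "self_map (\<lambda>x. x * moeb (of_real c) x)" by (rule self_map_mult_moeb[OF c(1,2)])
    show "\<forall>i\<in>I. Z i c \<in> unit_disc \<and> Z i c * moeb (of_real c) (Z i c) = \<alpha> i"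
      using ZD Z(2) mult_moeb_eq_iff[OF c(1,2)] by blast
    show "(\<Prod>i\<in>I. cmod (Z i c) ^ mu i) = s" using c(3) by (simp add: g_def Z(1))
  qed
qed

text \<open>Factoring through the squaring map replaces the product by its square root and so lowers
  \<open>n\<close> by one; once \<open>s^2\<close> is at most the product, the preceding lemma
  finishes. For \<open>n = 0\<close> the hypotheses force equality.\<close>

lemma lift_points_pow2:
  fixes \<alpha> :: "'i \<Rightarrow> complex"
  assumes I: "finite I" and s: "0 < s"
  shows "\<forall>i\<in>I. \<alpha> i \<in> unit_disc \<Longrightarrow> (\<Prod>i\<in>I. cmod (\<alpha> i) ^ mu i) \<le> s \<Longrightarrow>
    s ^ (2 ^ n) \<le> (\<Prod>i\<in>I. cmod (\<alpha> i) ^ mu i) \<Longrightarrow>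
    \<exists>k \<zeta>. self_map k \<and> (\<forall>i\<in>I. \<zeta> i \<in> unit_disc \<and> k (\<zeta> i) = \<alpha> i) \<and> (\<Prod>i\<in>I. cmod (\<zeta> i) ^ mu i) = s"
proof (induction n arbitrary: \<alpha>)
  case 0
  then show ?case by (intro exI[of _ "\<lambda>x. x"] exI[of _ \<alpha>]) (auto simp: self_map_id)
next
  case (Suc n)
  let ?P = "\<Prod>i\<in>I. cmod (\<alpha> i) ^ mu i"
  show ?case
  proof (cases "s\<^sup>2 \<le> ?P")
    case True
    then show ?thesis using lift_points_between_root_and_value[OF I Suc.prems(1) s Suc.prems(2)] by metis
  next
    case False
    define \<beta> where "\<beta> i = csqrt (\<alpha> i)" for i
    let ?Q = "\<Prod>i\<in>I. cmod (\<beta> i) ^ mu i"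
    have b2: "(cmod (\<beta> i))\<^sup>2 = cmod (\<alpha> i)" for i
      unfolding norm_power[symmetric] \<beta>_def by simp
    have Q0: "0 \<le> ?Q" by (intro prod_nonneg) auto
    have Q2: "?Q\<^sup>2 = ?P"
      unfolding prod_power_distrib by (intro prod.cong refl) (metis b2 power_mult mult.commute)
    have "\<beta> i \<in> unit_disc" if "i \<in> I" for i
    proof -
      have "(cmod (\<beta> i))\<^sup>2 < 1" using Suc.prems(1) that unfolding b2 by (simp add: unit_disc_def)
      then show ?thesis by (simp add: unit_disc_def power_less_one_iff)
    qed
    moreover have "?Q \<le> s"
    proof (rule power2_le_imp_le)
      show "?Q\<^sup>2 \<le> s\<^sup>2" unfolding Q2 using False by (simp only: not_le less_imp_le)
      show "0 \<le> s" using s by (rule less_imp_le)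
    qed
    moreover have "s ^ (2 ^ n) \<le> ?Q"
    proof (rule power2_le_imp_le[OF _ Q0])
      show "(s ^ 2 ^ n)\<^sup>2 \<le> ?Q\<^sup>2" using Suc.prems(3) unfolding Q2 by (simp only: power_mult[symmetric] power_Suc2)
    qed
    ultimately obtain k \<zeta> where k: "self_map k" "\<forall>i\<in>I. \<zeta> i \<in> unit_disc \<and> k (\<zeta> i) = \<beta> i"
      "(\<Prod>i\<in>I. cmod (\<zeta> i) ^ mu i) = s"
      using Suc.IH[of \<beta>] by blast
    have "self_map ((\<lambda>x. x\<^sup>2) \<circ> k)" by (intro self_map_comp self_map_square k)
    moreover have "\<forall>i\<in>I. \<zeta> i \<in> unit_disc \<and> ((\<lambda>x. x\<^sup>2) \<circ> k) (\<zeta> i) = \<alpha> i"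
      using k(2) by (simp add: \<beta>_def)
    ultimately show ?thesis using k(3) by blast
  qed
qed

text \<open>For nonzero points some \<open>s ^ (2 ^ n)\<close> falls below the product because
  \<open>s < 1\<close>. With a point at 0 the product vanishes and no \<open>n\<close> works, so one
  more map first moves all points off 0.\<close>

lemma lift_points:
  fixes \<alpha> :: "'i \<Rightarrow> complex"
  assumes I: "finite I" and mu: "\<forall>i\<in>I. mu i \<ge> 1" and s: "0 < s" "s < 1"
    and \<alpha>: "\<forall>i\<in>I. \<alpha> i \<in> unit_disc" "(\<Prod>i\<in>I. cmod (\<alpha> i) ^ mu i) \<le> s"
  obtains k \<zeta> where "self_map k" "\<forall>i\<in>I. \<zeta> i \<in> unit_disc \<and> k (\<zeta> i) = \<alpha> i" "(\<Prod>i\<in>I. cmod (\<zeta> i) ^ mu i) = s"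
proof -
  have nonzero: "\<exists>k \<zeta>. self_map k \<and> (\<forall>i\<in>I. \<zeta> i \<in> unit_disc \<and> k (\<zeta> i) = \<alpha> i) \<and> (\<Prod>i\<in>I. cmod (\<zeta> i) ^ mu i) = s"
    if \<alpha>: "\<forall>i\<in>I. \<alpha> i \<in> unit_disc" "(\<Prod>i\<in>I. cmod (\<alpha> i) ^ mu i) \<le> s" "\<forall>i\<in>I. \<alpha> i \<noteq> 0" for \<alpha> :: "'i \<Rightarrow> complex"
  proof -
    have "0 < (\<Prod>i\<in>I. cmod (\<alpha> i) ^ mu i)" using \<alpha>(3) by (intro prod_pos) auto
    then obtain n where n: "s ^ n < (\<Prod>i\<in>I. cmod (\<alpha> i) ^ mu i)" using real_arch_pow_inv s by blast
    have "s ^ (2 ^ n) \<le> s ^ n" using s by (intro power_decreasing) (auto simp: less_imp_le)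
    then show ?thesis using n \<alpha> by (intro lift_points_pow2[OF I s(1), where n = n]) auto
  qed
  show thesis
  proof (cases "\<forall>i\<in>I. \<alpha> i \<noteq> 0")
    case True
    then show thesis using nonzero[OF \<alpha> True] that by blast
  next
    case False
    then obtain j where j: "j \<in> I" "\<alpha> j = 0" by blast
    \<comment> \<open>\<open>x \<mapsto> x \<phi>\<^sub>s(x)\<close> takes the value 0 also at \<open>s\<close>, so all points lift to nonzero points.\<close>
    have "\<exists>x. x \<in> unit_disc \<and> x \<noteq> 0 \<and> x * moeb (of_real s) x = \<alpha> i \<and> (i = j \<longrightarrow> x = of_real s)" if i: "i \<in> I" for i
    proof (cases "\<alpha> i = 0")
      case True
      have "of_real s * moeb (of_real s) (of_real s) = \<alpha> i" using True by simp
      then show ?thesis using s by (intro exI[of _ "of_real s"]) (auto simp: unit_disc_def)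
    next
      case False
      obtain x where x: "x\<^sup>2 - of_real s * (1 + \<alpha> i) * x + \<alpha> i = 0" "(cmod x)\<^sup>2 \<le> cmod (\<alpha> i)"
        by (metis quadratic_small_root)
      have "(cmod x)\<^sup>2 < 1" using x(2) \<alpha> i by (force simp: unit_disc_def)
      then have xD: "x \<in> unit_disc" by (simp add: unit_disc_def power_less_one_iff)
      have "x * moeb (of_real s) x = \<alpha> i"
        using mult_moeb_eq_iff[of s x "\<alpha> i"] s xD x(1) by simp
      then show ?thesis using xD False j by (intro exI[of _ x]) auto
    qed
    then obtain \<beta> where \<beta>: "\<And>i. i \<in> I \<Longrightarrow> \<beta> i \<in> unit_disc" "\<And>i. i \<in> I \<Longrightarrow> \<beta> i \<noteq> 0"
      "\<And>i. i \<in> I \<Longrightarrow> \<beta> i * moeb (of_real s) (\<beta> i) = \<alpha> i" "\<beta> j = of_real s"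
      using j by metis
    \<comment> \<open>The point over \<open>\<alpha> j = 0\<close> is \<open>s\<close>, and its
      factor alone bounds the product by \<open>s ^ mu j \<le> s\<close>.\<close>
    have "(\<Prod>i\<in>I. cmod (\<beta> i) ^ mu i) = cmod (\<beta> j) ^ mu j * (\<Prod>i\<in>I - {j}. cmod (\<beta> i) ^ mu i)"
      using I j by (intro prod.remove)
    also have "\<dots> \<le> cmod (\<beta> j) ^ mu j * 1"
    proof (intro mult_left_mono prod_le_1)
      fix i assume "i \<in> I - {j}"
      then have "cmod (\<beta> i) \<le> 1" using \<beta>(1)[of i] by (simp add: unit_disc_def less_imp_le)
      then show "0 \<le> cmod (\<beta> i) ^ mu i \<and> cmod (\<beta> i) ^ mu i \<le> 1" by (simp add: power_le_one)
    qed simp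
    also have "\<dots> = s ^ mu j" using \<beta>(4) s by simp
    also have "\<dots> \<le> s ^ 1" using s mu j by (intro power_decreasing) auto
    finally have "(\<Prod>i\<in>I. cmod (\<beta> i) ^ mu i) \<le> s" by simp
    with \<beta> nonzero[of \<beta>] obtain k \<zeta> where k: "self_map k" "\<forall>i\<in>I. \<zeta> i \<in> unit_disc \<and> k (\<zeta> i) = \<beta> i"
      "(\<Prod>i\<in>I. cmod (\<zeta> i) ^ mu i) = s" by blast
    show thesis
    proof (rule that[OF _ _ k(3)])
      show "self_map ((\<lambda>x. x * moeb (of_real s) x) \<circ> k)"
        using s by (intro self_map_comp self_map_mult_moeb k) auto
      show "\<forall>i\<in>I. \<zeta> i \<in> unit_disc \<and> ((\<lambda>x. x * moeb (of_real s) x) \<circ> k) (\<zeta> i) = \<alpha> i"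
        using k(2) \<beta>(3) by simp
    qed
  qed
qed

text \<open>The involution \<open>moeb (fst z)\<close> sends 0 to \<open>fst z\<close> and
  \<open>\<alpha> i\<close> to \<open>a i\<close>, and the product of the |\<alpha> i| to the powers
  \<open>mu i\<close> is the Blaschke modulus at \<open>fst z\<close>. If |z_2| is larger,
  precomposing with the self-map of \<open>lift_points\<close> raises that product to exactly
  |z_2|.\<close>

lemma lempert_le_pole_fun:
  assumes I: "finite I" and a: "\<forall>i\<in>I. a i \<in> unit_disc" and mu: "\<forall>i\<in>I. mu i \<ge> 1" and z: "z \<in> bidisc"
  shows "lempert I (\<lambda>i. (a i, 0)) mu z \<le> pole_fun I a mu z"
proof -
  have z1: "fst z \<in> unit_disc" using z by (simp add: bidisc_def unit_disc_def)
  define \<alpha> where "\<alpha> i = moeb (fst z) (a i)" for i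
  have \<alpha>: "\<forall>i\<in>I. \<alpha> i \<in> unit_disc" using a z1 moeb_in_unit_disc by (auto simp: \<alpha>_def)
  have B: "cmod (\<Prod>i\<in>I. \<alpha> i ^ mu i) = cmod (fin_blaschke I a mu (fst z))"
    unfolding fin_blaschke_def prod_norm[symmetric] norm_power \<alpha>_def by (simp add: cmod_moeb_commute)
  note M = moeb_holomorphic[OF z1] moeb_in_unit_disc[OF z1]
  show ?thesis
  proof (cases "cmod (snd z) \<le> cmod (fin_blaschke I a mu (fst z))")
    case True
    have "cmod (snd z) \<le> cmod (\<Prod>i\<in>I. \<alpha> i ^ mu i)" using True by (simp only: B)
    then have "lempert I (\<lambda>i. (a i, 0)) mu z \<le> elog (\<Prod>i\<in>I. \<alpha> i ^ mu i)"
      using M \<alpha> a z1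
      by (intro lempert_le_of_interpolation[OF I mu z, of "moeb (fst z)"]) (auto simp: \<alpha>_def moeb_moeb)
    also have "\<dots> \<le> elog (fin_blaschke I a mu (fst z))" by (simp add: elog_le_iff B)
    finally show ?thesis by (simp add: pole_fun_def le_max_iff_disj)
  next
    case False
    define s where "s = cmod (snd z)"
    have s: "0 < s" "s < 1" using False z by (auto simp: s_def bidisc_def intro: le_less_trans[OF norm_ge_zero])
    have "(\<Prod>i\<in>I. cmod (\<alpha> i) ^ mu i) \<le> s"
      using False by (simp add: s_def B[symmetric] prod_norm[symmetric] norm_power)
    then obtain k \<zeta> where k: "self_map k" "\<forall>i\<in>I. \<zeta> i \<in> unit_disc \<and> k (\<zeta> i) = \<alpha> i"
      "(\<Prod>i\<in>I. cmod (\<zeta> i) ^ mu i) = s"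
      by (rule lift_points[OF I mu s \<alpha>])
    have P: "cmod (\<Prod>i\<in>I. \<zeta> i ^ mu i) = s" using k(3) by (simp add: prod_norm[symmetric] norm_power)
    have "lempert I (\<lambda>i. (a i, 0)) mu z \<le> elog (\<Prod>i\<in>I. \<zeta> i ^ mu i)"
    proof (rule lempert_le_of_interpolation[OF I mu z])
      show "(moeb (fst z) \<circ> k) holomorphic_on unit_disc"
        using k(1) M(1) by (intro holomorphic_on_compose_gen) (auto simp: self_map_def)
      show "(moeb (fst z) \<circ> k) ` unit_disc \<subseteq> unit_disc"
        using k(1) M(2) by (auto simp: self_map_def)
      show "(moeb (fst z) \<circ> k) 0 = fst z" using k(1) by (simp add: self_map_def)
      show "\<forall>i\<in>I. \<zeta> i \<in> unit_disc" using k by blast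
      show "\<forall>i\<in>I. (moeb (fst z) \<circ> k) (\<zeta> i) = a i"
        using k(2) a z1 by (simp add: \<alpha>_def moeb_moeb)
      show "cmod (snd z) \<le> cmod (\<Prod>i\<in>I. \<zeta> i ^ mu i)" unfolding P s_def by simp
    qed
    also have "\<dots> = elog (snd z)"
      by (intro antisym) (simp_all only: elog_le_iff P s_def order_refl)
    finally show ?thesis by (simp add: pole_fun_def le_max_iff_disj)
  qed
qed

section \<open>Equality of the three functions, and convergence\<close>

theorem lempert_green_eq_pole_fun:
  assumes "finite I" "\<forall>i\<in>I. a i \<in> unit_disc" "inj_on a I" "\<forall>i\<in>I. mu i \<ge> 1" "z \<in> bidisc"
  shows "lempert I (\<lambda>i. (a i, 0)) mu z = pole_fun I a mu z"
    and "green I (\<lambda>i. (a i, 0)) mu z = pole_fun I a mu z"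
proof -
  have "inj_on (\<lambda>i. (a i, 0 :: complex)) I" using assms(3) by (auto simp: inj_on_def)
  from green_le_lempert[OF assms(1) this assms(4)]
  have "green I (\<lambda>i. (a i, 0)) mu z \<le> lempert I (\<lambda>i. (a i, 0)) mu z" .
  moreover have "lempert I (\<lambda>i. (a i, 0)) mu z \<le> pole_fun I a mu z"
    "pole_fun I a mu z \<le> green I (\<lambda>i. (a i, 0)) mu z"
    using assms by (intro lempert_le_pole_fun pole_fun_le_green; simp)+
  ultimately show "lempert I (\<lambda>i. (a i, 0)) mu z = pole_fun I a mu z"
    "green I (\<lambda>i. (a i, 0)) mu z = pole_fun I a mu z" by auto
qed

text \<open>The \<open>m j\<close> simple factors with zeros tending to \<open>a j\<close> converge
  to the \<open>m j\<close>-th power of one factor. Continuity of \<open>elog\<close> at 0 covers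
  also the points where the limit product vanishes.\<close>

lemma tendsto_pole_fun_split:
  fixes N :: nat and m :: "nat \<Rightarrow> nat" and b :: "nat \<Rightarrow> nat \<Rightarrow> nat \<Rightarrow> complex"
  assumes a: "\<forall>j<N. a j \<in> unit_disc" and z: "fst z \<in> unit_disc"
    and lim: "\<forall>j<N. \<forall>i<m j. (\<lambda>k. b k j i) \<longlonglongrightarrow> a j"
  shows "(\<lambda>k. pole_fun {(j, i). j < N \<and> i < m j} (\<lambda>(j, i). b k j i) (\<lambda>_. 1) z)
    \<longlonglongrightarrow> pole_fun {..<N} a m z"
proof -
  have Sig: "{(j, i). j < N \<and> i < m j} = Sigma {..<N} (\<lambda>j. {..<m j})" by auto
  have eq: "fin_blaschke {(j, i). j < N \<and> i < m j} (\<lambda>(j, i). c j i) (\<lambda>_. 1) w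
      = (\<Prod>j<N. \<Prod>i<m j. moeb (c j i) w)" for c :: "nat \<Rightarrow> nat \<Rightarrow> complex" and w
    unfolding fin_blaschke_def Sig by (subst prod.Sigma) (auto simp: case_prod_unfold)
  have "(\<lambda>k. \<Prod>j<N. \<Prod>i<m j. moeb (b k j i) (fst z)) \<longlonglongrightarrow> (\<Prod>j<N. \<Prod>i<m j. moeb (a j) (fst z))"
  proof (intro tendsto_prod)
    fix j i assume "j \<in> {..<N}" "i \<in> {..<m j}"
    then have 1: "(\<lambda>k. b k j i) \<longlonglongrightarrow> a j" and 2: "1 - cnj (a j) * fst z \<noteq> 0"
      using lim a z moeb_denom_nz by (auto simp: unit_disc_def)
    show "(\<lambda>k. moeb (b k j i) (fst z)) \<longlonglongrightarrow> moeb (a j) (fst z)"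
      unfolding moeb_def by (intro tendsto_intros 1 2)
  qed
  then have "(\<lambda>k. fin_blaschke {(j, i). j < N \<and> i < m j} (\<lambda>(j, i). b k j i) (\<lambda>_. 1) (fst z))
      \<longlonglongrightarrow> fin_blaschke {..<N} a m (fst z)"
    unfolding eq by (simp add: fin_blaschke_def)
  then show ?thesis
    unfolding pole_fun_def by (intro tendsto_max tendsto_elog tendsto_const)
qed

theorem mainTheorem11:
  fixes N :: nat and a :: "nat \<Rightarrow> complex" and m :: "nat \<Rightarrow> nat"
  assumes a_in: "\<forall>j<N. a j \<in> unit_disc"
    and a_dist: "inj_on a {..<N}"
    and m_pos: "\<forall>j<N. m j \<ge> 1"
  shows "(\<forall>z\<in>bidisc.
            lempert {..<N} (\<lambda>j. (a j, 0)) m z = green {..<N} (\<lambda>j. (a j, 0)) m z \<and>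
            green {..<N} (\<lambda>j. (a j, 0)) m z =
              max (\<Sum>j<N. ereal (real (m j)) * elog (moeb (a j) (fst z))) (elog (snd z)))
       \<and> (\<forall>b :: nat \<Rightarrow> nat \<Rightarrow> nat \<Rightarrow> complex.
            (\<forall>k. \<forall>j<N. \<forall>i<m j. b k j i \<in> unit_disc) \<and>
            (\<forall>k. inj_on (\<lambda>(j, i). b k j i) {(j, i). j < N \<and> i < m j}) \<and>
            (\<forall>j<N. \<forall>i<m j. (\<lambda>k. b k j i) \<longlonglongrightarrow> a j)
          \<longrightarrow> (\<forall>z\<in>bidisc.
                (\<lambda>k. lempert {(j, i). j < N \<and> i < m j} (\<lambda>(j, i). (b k j i, 0)) (\<lambda>_. 1) z)
                  \<longlonglongrightarrow> lempert {..<N} (\<lambda>j. (a j, 0)) m z \<and>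
                (\<lambda>k. green {(j, i). j < N \<and> i < m j} (\<lambda>(j, i). (b k j i, 0)) (\<lambda>_. 1) z)
                  \<longlonglongrightarrow> green {..<N} (\<lambda>j. (a j, 0)) m z))"
proof (intro conjI ballI allI impI)
  have main: "lempert {..<N} (\<lambda>j. (a j, 0)) m z = pole_fun {..<N} a m z"
    "green {..<N} (\<lambda>j. (a j, 0)) m z = pole_fun {..<N} a m z" if "z \<in> bidisc" for z
    using lempert_green_eq_pole_fun[of "{..<N}" a m z] assms that by auto
  fix z assume z: "z \<in> bidisc"
  show "lempert {..<N} (\<lambda>j. (a j, 0)) m z = green {..<N} (\<lambda>j. (a j, 0)) m z"
    by (simp add: main[OF z])
  show "green {..<N} (\<lambda>j. (a j, 0)) m z =
      max (\<Sum>j<N. ereal (real (m j)) * elog (moeb (a j) (fst z))) (elog (snd z))"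
    by (simp add: main[OF z] pole_fun_def elog_fin_blaschke)
  fix b :: "nat \<Rightarrow> nat \<Rightarrow> nat \<Rightarrow> complex"
  let ?J = "{(j, i). j < N \<and> i < m j}"
  assume b: "(\<forall>k. \<forall>j<N. \<forall>i<m j. b k j i \<in> unit_disc) \<and>
            (\<forall>k. inj_on (\<lambda>(j, i). b k j i) ?J) \<and>
            (\<forall>j<N. \<forall>i<m j. (\<lambda>k. b k j i) \<longlonglongrightarrow> a j)"
  have fin: "finite ?J"
  proof -
    have "?J = Sigma {..<N} (\<lambda>j. {..<m j})" by auto
    then show ?thesis by simp
  qed
  \<comment> \<open>The split system is the case of all masses 1 of the general equality, with pairs
    as indices.\<close>
  have pts: "(\<lambda>(j, i). (b k j i, 0 :: complex)) = (\<lambda>x. ((\<lambda>(j, i). b k j i) x, 0))" for k by auto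
  have Sk: "lempert ?J (\<lambda>(j, i). (b k j i, 0)) (\<lambda>_. 1) z = pole_fun ?J (\<lambda>(j, i). b k j i) (\<lambda>_. 1) z"
    "green ?J (\<lambda>(j, i). (b k j i, 0)) (\<lambda>_. 1) z = pole_fun ?J (\<lambda>(j, i). b k j i) (\<lambda>_. 1) z" for k
    unfolding pts using b z by (intro lempert_green_eq_pole_fun[OF fin]; auto)+
  have "fst z \<in> unit_disc" using z by (simp add: bidisc_def unit_disc_def)
  from tendsto_pole_fun_split[OF a_in this] b
  have "(\<lambda>k. pole_fun ?J (\<lambda>(j, i). b k j i) (\<lambda>_. 1) z) \<longlonglongrightarrow> pole_fun {..<N} a m z" by blast
  then show "(\<lambda>k. lempert ?J (\<lambda>(j, i). (b k j i, 0)) (\<lambda>_. 1) z) \<longlonglongrightarrow> lempert {..<N} (\<lambda>j. (a j, 0)) m z"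
    "(\<lambda>k. green ?J (\<lambda>(j, i). (b k j i, 0)) (\<lambda>_. 1) z) \<longlonglongrightarrow> green {..<N} (\<lambda>j. (a j, 0)) m z"
    by (simp_all only: Sk main[OF z])
qed

end
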